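(* Let $V$ be a finite dimensional real vector space, $B\subseteq V$ a compact convex polyhedral $0$-neighborhood with associated asymmetric polyhedral norm $\nu$. Let $p\in V$ and $L\in\Sigma\cup\{K\}$. Then the set $$\{U(L,\varepsilon,p+q)\mid q\in H_L^+\text{ and }\varepsilon>0\}$$ is a neighborhood basis of the point $p+H_L\in V_L$ in $\bigsqcup\{V_{L'}\mid L'\in\Sigma\cup\{K\}\}$, in the topology imposed by the bijection $\Phi$ from the bordification $\widehat V$.
   Context: $V$ is a finite dimensional real vector space with dual $V^\vee$, endowed with a Euclidean norm $\|\cdot\|$; $B_\varepsilon(0)=\{v\in V\mid\|v\|<\varepsilon\}$, and $0$ is the base point. $B\subseteq V$ is a compact convex polyhedral neighborhood of $0$ with codimension-1 faces $A_0,\dots,A_m$, and $K=\{0,\dots,m\}$. For each $j\in K$, $\xi_j\in V^\vee$ is the unique linear functional with $A_j=\{v\in B\mid \xi_j(v)=1\}$; thus $B=\{u\in V\mid \xi_j(u)\le 1\text{ for all }j\in K\}$, and the asymmetric norm with unit ball $B$ is $\nu(u)=\max\{\xi_0(u),\dots,\xi_m(u)\}$. Put $\delta(u,v)=\nu(u-v)$. A nonempty subset $L\subseteq K$ is a dual face if there is $v\in V$ with $\nu(v)=1$ and $L=\{k\in K\mid \xi_k(v)=1\}$; $\Sigma$ is the set of all dual faces. For nonempty $L\subseteq K$: $\nu_L(u)=\max\{\xi_\ell(u)\mid \ell\in L\}$ and $H_L=\{u\in V\mid \xi_k(u)=\xi_\ell(u)\text{ for all }k,\ell\in L\}$ (so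 $H_K=\{0\}$). For $L\in\Sigma$, $H_L^+=\{v\in H_L\mid \xi_\ell(v)>\xi_k(v)\text{ for all }\ell\in L\text{ and }k\in K\setminus L\}$; also $H_K^+=\{0\}$. Put $V_K=V$ and $V_L=V/H_L$ for $L\in\Sigma$. For $L\in\Sigma$, $\varepsilon>0$, $q\in V$ put $D=q+B_\varepsilon(0)+H_L^+\subseteq V=V_K$ and $$U(L,\varepsilon,q)=D\sqcup\bigsqcup\{(D+H_{L'})/H_{L'}\mid L'\in\Sigma,\ L'\supseteq L\}\subseteq\bigsqcup\{V_{L'}\mid L'\in\Sigma\cup\{K\}\},$$ where $(D+H_{L'})/H_{L'}\subseteq V_{L'}$; and $U(K,\varepsilon,q)=q+B_\varepsilon(0)\subseteq V=V_K$. The bordification $\widehat V$ is the closure of $\{u\mapsto\delta(p,u)-\delta(p,0)\mid p\in V\}$ in the space of continuous functions $f:V\to\mathbb R$ with $f(0)=0$, in the topology of uniform convergence on bounded sets. Its elements are exactly the functions $v\mapsto\nu(p-v)-\nu(p)$ with $p\in V$ and $v\mapsto\nu_L(p-v)-\nu_L(p)$ with $p\in V$, $L\in\Sigma$. The map $\Phi:\widehat V\to\bigsqcup\{V_L\mid L\in\Sigma\cup\{K\}\}$ sending the former to $p\in V_K$ and the latter to $p+H_L\in V_L$ is a bijection; the topology imposed by $\Phi$ is the one making $\Phi$ a homeomorphism. *)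

theory Defs
  imports "HOL-Analysis.Analysis"
begin

text \<open>
  Throughout, \<open>K\<close> is the index set of the facets of the unit ball and \<open>\<xi> k\<close> the linear
  functional that is constantly 1 on the facet with index \<open>k\<close>. The ambient space \<open>V\<close> is a type of
  class \<open>euclidean_space\<close>.
\<close>

subsection \<open>The asymmetric norm and its dual faces\<close>

definition nu_on :: "('k \<Rightarrow> 'a \<Rightarrow> real) \<Rightarrow> 'k set \<Rightarrow> 'a \<Rightarrow> real" where
  "nu_on \<xi> L u = Max ((\<lambda>l. \<xi> l u) ` L)"

abbreviation nu :: "'k set \<Rightarrow> ('k \<Rightarrow> 'a \<Rightarrow> real) \<Rightarrow> 'a \<Rightarrow> real" where
  "nu K \<xi> \<equiv> nu_on \<xi> K"

definition delta :: "'k set \<Rightarrow> ('k \<Rightarrow> 'a::euclidean_space \<Rightarrow> real) \<Rightarrow> 'a \<Rightarrow> 'a \<Rightarrow> real" where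
  "delta K \<xi> u v = nu K \<xi> (u - v)"

definition dual_faces :: "'k set \<Rightarrow> ('k \<Rightarrow> 'a \<Rightarrow> real) \<Rightarrow> 'k set set" where
  "dual_faces K \<xi> =
    {L. L \<noteq> {} \<and> L \<subseteq> K \<and> (\<exists>v. nu K \<xi> v = 1 \<and> L = {k\<in>K. \<xi> k v = 1})}"

definition H :: "('k \<Rightarrow> 'a \<Rightarrow> real) \<Rightarrow> 'k set \<Rightarrow> 'a set" where
  "H \<xi> L = {u. \<forall>k\<in>L. \<forall>l\<in>L. \<xi> k u = \<xi> l u}"

definition Hplus :: "'k set \<Rightarrow> ('k \<Rightarrow> 'a::euclidean_space \<Rightarrow> real) \<Rightarrow> 'k set \<Rightarrow> 'a set" where
  "Hplus K \<xi> L =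
    (if L = K then {0} else {v \<in> H \<xi> L. \<forall>l\<in>L. \<forall>k\<in>K - L. \<xi> l v > \<xi> k v})"

subsection \<open>The disjoint union of the quotients of \<open>V\<close>\<close>

definition coset :: "('k \<Rightarrow> 'a::euclidean_space \<Rightarrow> real) \<Rightarrow> 'k set \<Rightarrow> 'a \<Rightarrow> 'a set" where
  "coset \<xi> L p = (+) p ` H \<xi> L"

text \<open>
  A point of the summand with index \<open>L\<close> is a pair of \<open>L\<close> and a coset of \<open>H \<xi> L\<close>. For a compact
  unit ball \<open>H \<xi> K = {0}\<close>, so an element \<open>v\<close> of the summand \<open>V\<close> with index \<open>K\<close> is
  represented by \<open>(K, {v})\<close>, and \<open>coset \<xi> K v = {v}\<close>.
\<close>

definition quotient_union ::
    "'k set \<Rightarrow> ('k \<Rightarrow> 'a::euclidean_space \<Rightarrow> real) \<Rightarrow> ('k set \<times> 'a set) set" where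
  "quotient_union K \<xi> =
    {K} \<times> range (\<lambda>v. {v}) \<union> (SIGMA L:dual_faces K \<xi>. range (coset \<xi> L))"

definition U ::
    "'k set \<Rightarrow> ('k \<Rightarrow> 'a::euclidean_space \<Rightarrow> real) \<Rightarrow> 'k set \<Rightarrow> real \<Rightarrow> 'a
      \<Rightarrow> ('k set \<times> 'a set) set" where
  "U K \<xi> L \<epsilon> q =
    (if L = K then {K} \<times> (\<lambda>v. {v}) ` {q + b | b. b \<in> ball 0 \<epsilon>}
     else let D = {q + b + h | b h. b \<in> ball 0 \<epsilon> \<and> h \<in> Hplus K \<xi> L} in
       {K} \<times> (\<lambda>v. {v}) ` D \<union>
       (SIGMA L':{L' \<in> dual_faces K \<xi>. L \<subseteq> L'}.
          coset \<xi> L' ` {d + h | d h. d \<in> D \<and> h \<in> H \<xi> L'}))"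

subsection \<open>The bordification\<close>

definition based_functions :: "('a::euclidean_space \<Rightarrow> real) set" where
  "based_functions = {f. continuous_on UNIV f \<and> f 0 = 0}"

text \<open>The topology of uniform convergence on bounded sets.\<close>

definition bounded_convergence_topology :: "('a::euclidean_space \<Rightarrow> real) topology" where
  "bounded_convergence_topology = topology (\<lambda>W. W \<subseteq> based_functions \<and>
     (\<forall>f\<in>W. \<exists>S e. bounded S \<and> e > 0 \<and>
        {g \<in> based_functions. \<forall>x\<in>S. \<bar>g x - f x\<bar> < e} \<subseteq> W))"

lemma openin_bounded_convergence_topology:
  "openin bounded_convergence_topology W \<longleftrightarrow> W \<subseteq> based_functions \<and>
     (\<forall>f\<in>W. \<exists>S e. bounded S \<and> e > 0 \<and>
        {g \<in> based_functions. \<forall>x\<in>S. \<bar>g x - f x\<bar> < e} \<subseteq> W)"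
proof -
  define N where "N f S e = {g \<in> based_functions. \<forall>x\<in>S. \<bar>g x - f x\<bar> < e}"
    for f :: "'a \<Rightarrow> real" and S :: "'a set" and e :: real
  define nbd where "nbd f W \<longleftrightarrow> (\<exists>S e. bounded S \<and> e > 0 \<and> N f S e \<subseteq> W)" for f W
  define P where "P W \<longleftrightarrow> W \<subseteq> based_functions \<and> (\<forall>f\<in>W. nbd f W)" for W
  have nbd_Int: "nbd f (W1 \<inter> W2)" if nbd1: "nbd f W1" and nbd2: "nbd f W2" for f W1 W2
  proof -
    obtain S1 e1 where 1: "bounded S1" "e1 > 0" "N f S1 e1 \<subseteq> W1"
      using nbd1 unfolding nbd_def by blast
    obtain S2 e2 where 2: "bounded S2" "e2 > 0" "N f S2 e2 \<subseteq> W2"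
      using nbd2 unfolding nbd_def by blast
    have "N f (S1 \<union> S2) (min e1 e2) \<subseteq> N f S1 e1 \<inter> N f S2 e2" unfolding N_def by auto
    then have "N f (S1 \<union> S2) (min e1 e2) \<subseteq> W1 \<inter> W2" using 1(3) 2(3) by blast
    moreover have "bounded (S1 \<union> S2)" "min e1 e2 > 0" using 1 2 by simp_all
    ultimately show ?thesis unfolding nbd_def by blast
  qed
  have nbd_mono: "nbd f W'" if "nbd f W" "W \<subseteq> W'" for f W W'
    using that unfolding nbd_def by (meson subset_trans)
  have "P (W1 \<inter> W2)" if "P W1" "P W2" for W1 W2
    using that nbd_Int unfolding P_def by blast
  moreover have "P (\<Union>\<W>)" if \<W>: "\<forall>W\<in>\<W>. P W" for \<W>
    unfolding P_def
  proof (intro conjI ballI)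
    show "\<Union>\<W> \<subseteq> based_functions" using \<W> unfolding P_def by blast
    fix f assume "f \<in> \<Union>\<W>"
    then obtain W where "W \<in> \<W>" "f \<in> W" by blast
    then show "nbd f (\<Union>\<W>)" using \<W> nbd_mono unfolding P_def by (meson Union_upper)
  qed
  ultimately have "istopology P" by (simp add: istopology_def)
  then have "openin (topology P) W \<longleftrightarrow> P W" by (simp add: topology_inverse')
  moreover have "topology P = bounded_convergence_topology"
    unfolding bounded_convergence_topology_def P_def[abs_def] nbd_def N_def ..
  ultimately show ?thesis by (simp only: P_def nbd_def N_def)
qed

definition bordification ::
    "'k set \<Rightarrow> ('k \<Rightarrow> 'a::euclidean_space \<Rightarrow> real) \<Rightarrow> ('a \<Rightarrow> real) set" where
  "bordification K \<xi> =
    bounded_convergence_topology closure_of {\<lambda>u. delta K \<xi> p u - delta K \<xi> p 0 | p. True}"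

definition Phi ::
    "'k set \<Rightarrow> ('k \<Rightarrow> 'a::euclidean_space \<Rightarrow> real) \<Rightarrow> ('a \<Rightarrow> real) \<Rightarrow> 'k set \<times> 'a set" where
  "Phi K \<xi> f = (THE x.
     (\<exists>p. f = (\<lambda>v. nu K \<xi> (p - v) - nu K \<xi> p) \<and> x = (K, {p})) \<or>
     (\<exists>L\<in>dual_faces K \<xi>. \<exists>p.
        f = (\<lambda>v. nu_on \<xi> L (p - v) - nu_on \<xi> L p) \<and> x = (L, coset \<xi> L p)))"

text \<open>
  The bijection \<open>Phi\<close> is a homeomorphism onto the disjoint union precisely when the topology
  there is the pullback along the inverse of \<open>Phi\<close>.
\<close>

definition Phi_topology ::
    "'k set \<Rightarrow> ('k \<Rightarrow> 'a::euclidean_space \<Rightarrow> real) \<Rightarrow> ('k set \<times> 'a set) topology" where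
  "Phi_topology K \<xi> =
    pullback_topology (quotient_union K \<xi>) (inv_into (bordification K \<xi>) (Phi K \<xi>))
      (subtopology bounded_convergence_topology (bordification K \<xi>))"

text \<open>The members of a neighborhood basis need not be open.\<close>

definition neighborhood_basis_at :: "'b topology \<Rightarrow> 'b \<Rightarrow> 'b set set \<Rightarrow> bool" where
  "neighborhood_basis_at T x \<N> \<longleftrightarrow> x \<in> topspace T \<and>
    (\<forall>N\<in>\<N>. N \<subseteq> topspace T \<and> (\<exists>W. openin T W \<and> x \<in> W \<and> W \<subseteq> N)) \<and>
    (\<forall>W. openin T W \<and> x \<in> W \<longrightarrow> (\<exists>N\<in>\<N>. N \<subseteq> W))"

end

theory Submission
  imports Defs
begin

text \<open>
  A point \<open>p + H \<xi> L\<close> of the disjoint union corresponds to the horofunction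
  \<open>v \<mapsto> nu_on \<xi> L (p - v) - nu_on \<xi> L p\<close>. Moving \<open>p\<close> far into \<open>Hplus K \<xi> L\<close> makes the functionals
  outside \<open>L\<close> irrelevant for the maximum on a given ball, so all horofunctions of points of
  \<open>U K \<xi> L \<epsilon> (p + q)\<close> are close to that of \<open>p + H \<xi> L\<close> there. Conversely, choose for each facet
  a relatively interior point \<open>w k\<close>. For \<open>v\<close> on the ray through \<open>- w k\<close> the number
  \<open>\<xi> k (p - v)\<close> grows faster than \<open>\<xi> j (p - v)\<close> for all other \<open>j\<close>, so the value of a horofunction far out on this ray tells whether
  \<open>k \<in> L\<close>, and determines \<open>\<xi> k p - nu_on \<xi> L p\<close> if it is. Hence a horofunction close to that of
  \<open>p + H \<xi> L\<close> on a large ball comes from some \<open>L' \<supseteq> L\<close> and from a point whose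
  coordinates in \<open>L\<close> are close to those of \<open>p\<close> and dominate the remaining ones, that is, from
  a point of \<open>U K \<xi> L \<epsilon> (p + q)\<close>. The same rays show that limits of horofunctions are horofunctions.
\<close>

section \<open>Uniform convergence on bounded sets\<close>

lemma openin_based_functions: "openin bounded_convergence_topology based_functions"
  unfolding openin_bounded_convergence_topology by (auto intro: exI[of _ "{}"] exI[of _ "1::real"])

text \<open>The bound \<open>d < e\<close> is uniform over \<open>S\<close>. With only pointwise
  \<open>\<bar>g x - f x\<bar> < e\<close> the supremum could equal \<open>e\<close> and leave no
  room around \<open>g\<close>. Here half of the slack \<open>e - d\<close> serves as
  radius.\<close>

lemma openin_uniform_neighborhood:
  assumes "bounded S"
  shows "openin bounded_convergence_topology
    {g \<in> based_functions. \<exists>d<e. \<forall>x\<in>S. \<bar>g x - f x\<bar> \<le> (d::real)}"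
  unfolding openin_bounded_convergence_topology
proof (intro conjI ballI)
  fix g assume "g \<in> {g \<in> based_functions. \<exists>d<e. \<forall>x\<in>S. \<bar>g x - f x\<bar> \<le> d}"
  then obtain d where d: "d < e" "\<forall>x\<in>S. \<bar>g x - f x\<bar> \<le> d" by blast
  have "\<exists>d<e. \<forall>x\<in>S. \<bar>g' x - f x\<bar> \<le> d" if g': "\<forall>x\<in>S. \<bar>g' x - g x\<bar> < (e - d) / 2" for g'
  proof (intro exI[of _ "(e + d) / 2"] conjI ballI)
    show "(e + d) / 2 < e" using d by simp
    fix x assume "x \<in> S"
    then have "\<bar>g' x - g x\<bar> < (e - d) / 2" "\<bar>g x - f x\<bar> \<le> d" using g' d by auto
    then show "\<bar>g' x - f x\<bar> \<le> (e + d) / 2" by (simp add: field_simps abs_if split: if_splits)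
  qed
  then show "\<exists>S' e'. bounded S' \<and> 0 < e' \<and> {g' \<in> based_functions. \<forall>x\<in>S'. \<bar>g' x - g x\<bar> < e'} \<subseteq>
      {g \<in> based_functions. \<exists>d<e. \<forall>x\<in>S. \<bar>g x - f x\<bar> \<le> d}"
    using assms d(1) by (intro exI[of _ S] exI[of _ "(e - d) / 2"]) auto
qed blast

lemma open_bounded_convergenceD:
  assumes "openin bounded_convergence_topology V" "f \<in> V"
  obtains R e where "0 \<le> R" "0 < e"
    "\<And>g. g \<in> based_functions \<Longrightarrow> (\<And>v. norm v \<le> R \<Longrightarrow> \<bar>g v - f v\<bar> < e) \<Longrightarrow> g \<in> V"
proof -
  obtain S e where S: "bounded S" "0 < e" "{g \<in> based_functions. \<forall>x\<in>S. \<bar>g x - f x\<bar> < e} \<subseteq> V"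
    using assms unfolding openin_bounded_convergence_topology by blast
  obtain R where R: "0 < R" "\<And>x. x \<in> S \<Longrightarrow> norm x \<le> R" using S(1) unfolding bounded_pos by blast
  then show thesis using S by (intro that[of R e]) auto
qed

lemma bounded_convergence_closureI:
  assumes "f \<in> based_functions" "X \<subseteq> based_functions"
    and approx: "\<And>R e. 0 \<le> R \<Longrightarrow> 0 < e \<Longrightarrow> \<exists>g\<in>X. \<forall>v. norm v \<le> R \<longrightarrow> \<bar>g v - f v\<bar> < e"
  shows "f \<in> bounded_convergence_topology closure_of X"
  unfolding in_closure_of
proof (intro conjI allI impI)
  show "f \<in> topspace bounded_convergence_topology"
    using assms(1) openin_subset[OF openin_based_functions] by blast
  fix V assume V: "f \<in> V \<and> openin bounded_convergence_topology V"
  then obtain R e where R: "0 \<le> R" "0 < e"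
    "\<And>g. g \<in> based_functions \<Longrightarrow> (\<And>v. norm v \<le> R \<Longrightarrow> \<bar>g v - f v\<bar> < e) \<Longrightarrow> g \<in> V"
    using open_bounded_convergenceD by metis
  then show "\<exists>g. g \<in> X \<and> g \<in> V" using approx[OF R(1,2)] assms(2) by blast
qed

lemma bounded_convergence_closureD:
  assumes f: "f \<in> bounded_convergence_topology closure_of X" and "0 < e"
  obtains g where "g \<in> X" "\<And>v. norm v \<le> R \<Longrightarrow> \<bar>g v - f v\<bar> < e"
proof -
  define V where "V = {g \<in> based_functions. \<exists>d<e. \<forall>v\<in>cball 0 R. \<bar>g v - f v\<bar> \<le> d}"
  have V: "openin bounded_convergence_topology V"
    unfolding V_def by (intro openin_uniform_neighborhood) simp
  have "f \<in> based_functions"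
    using f openin_topspace[of bounded_convergence_topology]
    unfolding in_closure_of openin_bounded_convergence_topology by blast
  then have "f \<in> V" using \<open>0 < e\<close> by (auto simp: V_def)
  then obtain g where "g \<in> X" "g \<in> V" using f V unfolding in_closure_of by blast
  moreover then have "\<bar>g v - f v\<bar> < e" if "norm v \<le> R" for v
    using that by (force simp: V_def)
  ultimately show thesis using that by blast
qed

section \<open>Maxima of finitely many linear functionals\<close>

lemma finite_uniform_gap:
  fixes f :: "'b \<Rightarrow> real"
  assumes "finite A" "\<And>x. x \<in> A \<Longrightarrow> 0 < f x"
  obtains c where "0 < c" "\<And>x. x \<in> A \<Longrightarrow> c \<le> f x"
proof
  \<comment> \<open>The inserted 1 is a default value for empty \<open>A\<close>, which occurs for
    instance when there is no functional outside \<open>L\<close>.\<close>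
  show "0 < Min (insert 1 (f ` A))"
    using assms by (subst Min_gr_iff) auto
  show "Min (insert 1 (f ` A)) \<le> f x" if "x \<in> A" for x
    using assms(1) that by (intro Min_le) auto
qed

lemma nu_on_ge: "finite L \<Longrightarrow> l \<in> L \<Longrightarrow> \<xi> l u \<le> nu_on \<xi> L u"
  by (simp add: nu_on_def)

lemma nu_on_attained:
  assumes "finite L" "L \<noteq> {}"
  obtains l where "l \<in> L" "nu_on \<xi> L u = \<xi> l u"
proof -
  have "nu_on \<xi> L u \<in> (\<lambda>l. \<xi> l u) ` L" unfolding nu_on_def using assms by (intro Max_in) auto
  then show thesis using that by blast
qed

lemma nu_on_leI:
  "finite L \<Longrightarrow> L \<noteq> {} \<Longrightarrow> (\<And>l. l \<in> L \<Longrightarrow> \<xi> l u \<le> c) \<Longrightarrow> nu_on \<xi> L u \<le> c"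
  by (simp add: nu_on_def)

lemma nu_on_dominated:
  assumes "finite L'" "L \<subseteq> L'" "L \<noteq> {}" "\<And>k. k \<in> L' - L \<Longrightarrow> \<exists>l\<in>L. \<xi> k u \<le> \<xi> l u"
  shows "nu_on \<xi> L' u = nu_on \<xi> L u"
proof (rule antisym)
  have fin: "finite L" using assms finite_subset by blast
  show "nu_on \<xi> L' u \<le> nu_on \<xi> L u"
  proof (rule nu_on_leI)
    fix k assume k: "k \<in> L'"
    show "\<xi> k u \<le> nu_on \<xi> L u"
    proof (cases "k \<in> L")
      case False
      then obtain l where "l \<in> L" "\<xi> k u \<le> \<xi> l u" using assms(4) k by blast
      then show ?thesis using nu_on_ge[OF fin, of l \<xi> u] by linarith
    qed (simp add: nu_on_ge fin)
  qed (use assms in auto)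
  show "nu_on \<xi> L u \<le> nu_on \<xi> L' u"
    using assms fin by (intro nu_on_leI nu_on_ge) auto
qed

section \<open>Horofunctions of a polyhedral norm\<close>

definition horo :: "('k \<Rightarrow> 'a::euclidean_space \<Rightarrow> real) \<Rightarrow> 'k set \<Rightarrow> 'a \<Rightarrow> 'a \<Rightarrow> real" where
  "horo \<xi> L p = (\<lambda>v. nu_on \<xi> L (p - v) - nu_on \<xi> L p)"

text \<open>
  The vector \<open>w k\<close> stands for a point in the relative interior of the facet with index \<open>k\<close>; such
  points exist precisely because no facet is redundant.
\<close>

locale polyhedral_norm =
  fixes K :: "'k set" and \<xi> :: "'k \<Rightarrow> 'a::euclidean_space \<Rightarrow> real"
    and w :: "'k \<Rightarrow> 'a" and \<eta> :: real
  assumes finite_K: "finite K" and K_nonempty: "K \<noteq> {}"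
    and linear: "k \<in> K \<Longrightarrow> linear (\<xi> k)"
    and definite: "(\<And>k. k \<in> K \<Longrightarrow> \<xi> k u \<le> 0) \<Longrightarrow> u = 0"
    and peak: "k \<in> K \<Longrightarrow> \<xi> k (w k) = 1"
    and eta_pos: "0 < \<eta>"
    and off_peak: "j \<in> K \<Longrightarrow> k \<in> K \<Longrightarrow> j \<noteq> k \<Longrightarrow> \<xi> j (w k) \<le> 1 - \<eta>"
begin

abbreviation faces :: "'k set set" where "faces \<equiv> insert K (dual_faces K \<xi>)"

lemma facesD: assumes "L \<in> faces" shows "L \<subseteq> K" "L \<noteq> {}" "finite L"
  using assms finite_K K_nonempty by (auto simp: dual_faces_def intro: finite_subset)

lemma xi_add: "k \<in> K \<Longrightarrow> \<xi> k (u + v) = \<xi> k u + \<xi> k v"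
  and xi_diff: "k \<in> K \<Longrightarrow> \<xi> k (u - v) = \<xi> k u - \<xi> k v"
  and xi_minus: "k \<in> K \<Longrightarrow> \<xi> k (- v) = - \<xi> k v"
  and xi_scale: "k \<in> K \<Longrightarrow> \<xi> k (r *\<^sub>R v) = r * \<xi> k v"
  and xi_zero: "k \<in> K \<Longrightarrow> \<xi> k 0 = 0"
  using linear by (simp_all add: linear_add linear_diff linear_neg linear_cmul linear_0)

lemmas xi_simps = xi_add xi_diff xi_minus xi_scale xi_zero

lemma xi_bound:
  obtains C where "0 < C" "\<And>k u. k \<in> K \<Longrightarrow> \<bar>\<xi> k u\<bar> \<le> C * norm u"
proof
  have bl: "bounded_linear (\<xi> k)" if "k \<in> K" for k
    using linear[OF that] by (simp add: linear_conv_bounded_linear)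
  have nn: "0 \<le> (\<Sum>k\<in>K. onorm (\<xi> k))" using bl by (intro sum_nonneg onorm_pos_le)
  then show "0 < 1 + (\<Sum>k\<in>K. onorm (\<xi> k))" by linarith
  show "\<bar>\<xi> k u\<bar> \<le> (1 + (\<Sum>k\<in>K. onorm (\<xi> k))) * norm u" if k: "k \<in> K" for k u
  proof -
    have "\<bar>\<xi> k u\<bar> \<le> onorm (\<xi> k) * norm u" using onorm[OF bl[OF k], of u] by simp
    also have "\<dots> \<le> (\<Sum>k\<in>K. onorm (\<xi> k)) * norm u"
      using k finite_K bl by (intro mult_right_mono member_le_sum) (auto intro: onorm_pos_le)
    also have "\<dots> \<le> (1 + (\<Sum>k\<in>K. onorm (\<xi> k))) * norm u"
      by (simp add: distrib_right)
    finally show ?thesis .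
  qed
qed

lemma w_bound:
  obtains W where "0 < W" "\<And>k. k \<in> K \<Longrightarrow> norm (w k) \<le> W"
proof
  show "0 < 1 + (\<Sum>k\<in>K. norm (w k))" by (smt (verit) sum_nonneg norm_ge_zero)
  show "norm (w k) \<le> 1 + (\<Sum>k\<in>K. norm (w k))" if "k \<in> K" for k
    using member_le_sum[OF that, of "\<lambda>k. norm (w k)"] finite_K by simp
qed

section \<open>The subspaces \<open>H\<close> and the cones \<open>Hplus\<close>\<close>

lemma H_I: "(\<And>k l. k \<in> L \<Longrightarrow> l \<in> L \<Longrightarrow> \<xi> k u = \<xi> l u) \<Longrightarrow> u \<in> H \<xi> L"
  and H_D: "u \<in> H \<xi> L \<Longrightarrow> k \<in> L \<Longrightarrow> l \<in> L \<Longrightarrow> \<xi> k u = \<xi> l u"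
  unfolding H_def by blast+

lemma subspace_H: assumes L: "L \<subseteq> K" shows "subspace (H \<xi> L)"
  unfolding subspace_def
proof (intro conjI ballI allI)
  have K: "k \<in> K" if "k \<in> L" for k using that L by blast
  show "0 \<in> H \<xi> L" by (rule H_I) (simp add: K xi_zero)
  fix u assume u: "u \<in> H \<xi> L"
  show "r *\<^sub>R u \<in> H \<xi> L" for r
    by (rule H_I) (simp add: K xi_scale, metis H_D[OF u])
  show "u + v \<in> H \<xi> L" if v: "v \<in> H \<xi> L" for v
    by (rule H_I) (simp add: K xi_add, metis H_D[OF u] H_D[OF v])
qed

lemma H_antimono: "L \<subseteq> L' \<Longrightarrow> H \<xi> L' \<subseteq> H \<xi> L"
  by (auto simp: H_def)

text \<open>All functionals agree at an element \<open>u\<close> of \<open>H \<xi> K\<close>, so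
  they are all nonpositive at \<open>u\<close> or all nonpositive at \<open>- u\<close>, and
  definiteness applies.\<close>

lemma H_K: "H \<xi> K = {0}"
proof -
  have "u = 0" if u: "u \<in> H \<xi> K" for u
  proof -
    obtain k0 where k0: "k0 \<in> K" using K_nonempty by blast
    have eq: "\<xi> k u = \<xi> k0 u" if "k \<in> K" for k using H_D[OF u that k0] .
    show ?thesis
    proof (cases "\<xi> k0 u \<le> 0")
      case True then show ?thesis using eq by (intro definite) auto
    next
      case False
      then have "- u = 0" using eq by (intro definite) (auto simp: xi_minus)
      then show ?thesis by simp
    qed
  qed
  then show ?thesis using subspace_0[OF subspace_H[of K]] by auto
qed

text \<open>For \<open>L = K\<close> the inequalities are vacuous and \<open>H_K\<close> leaves only
  0, so the case distinction in \<open>Hplus\<close> disappears.\<close>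

lemma Hplus_eq:
  "Hplus K \<xi> L = {v \<in> H \<xi> L. \<forall>l\<in>L. \<forall>k\<in>K - L. \<xi> k v < \<xi> l v}"
  using H_K by (auto simp: Hplus_def)

lemma Hplus_scale: "L \<subseteq> K \<Longrightarrow> v \<in> Hplus K \<xi> L \<Longrightarrow> 0 < t \<Longrightarrow> t *\<^sub>R v \<in> Hplus K \<xi> L"
  using subspace_scale[OF subspace_H] by (auto simp: Hplus_eq xi_scale subset_iff)

lemma Hplus_gap:
  assumes L: "L \<subseteq> K" and v: "v \<in> Hplus K \<xi> L"
  obtains c where "0 < c" "\<And>l k. l \<in> L \<Longrightarrow> k \<in> K - L \<Longrightarrow> c \<le> \<xi> l v - \<xi> k v"
proof -
  have "finite (L \<times> (K - L))" using L finite_K finite_subset by blast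
  then obtain c where "0 < c" "\<And>x. x \<in> L \<times> (K - L) \<Longrightarrow> c \<le> (case x of (l, k) \<Rightarrow> \<xi> l v - \<xi> k v)"
    by (rule finite_uniform_gap[where f = "\<lambda>(l, k). \<xi> l v - \<xi> k v"])
      (use v in \<open>auto simp: Hplus_eq\<close>)
  then show thesis using that by auto
qed

lemma Hplus_nonempty:
  assumes "L \<in> faces" obtains v where "v \<in> Hplus K \<xi> L"
proof (cases "L = K")
  case True then show thesis using that by (auto simp: Hplus_def)
next
  case False
  \<comment> \<open>The vector that witnesses the dual face lies in the cone itself.\<close>
  then obtain v where v: "nu K \<xi> v = 1" "L = {k\<in>K. \<xi> k v = 1}"
    using assms by (auto simp: dual_faces_def)
  then have "\<xi> k v < 1" if "k \<in> K - L" for k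
    using nu_on_ge[OF finite_K, of k \<xi> v] that by force
  then have "v \<in> Hplus K \<xi> L" using v by (auto simp: Hplus_eq H_def)
  then show thesis by (rule that)
qed

text \<open>The common value of the functionals in \<open>L\<close> at \<open>v\<close> is their
  maximum over \<open>K\<close>. If \<open>L\<close> is not \<open>K\<close>, definiteness makes it
  positive, and scaling it to 1 turns \<open>v\<close> into a witness for a dual face. This
  recognizes the index set found in \<open>horo_limit\<close> as a face.\<close>

lemma Hplus_imp_face:
  assumes L: "L \<subseteq> K" "L \<noteq> {}" and v: "v \<in> Hplus K \<xi> L"
  shows "L \<in> faces"
proof (cases "L = K")
  case False
  obtain l0 where l0: "l0 \<in> L" using L by blast
  have lt: "\<xi> k v < \<xi> l0 v" if "k \<in> K - L" for k using v that l0 by (auto simp: Hplus_eq)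
  have eq: "\<xi> k v = \<xi> l0 v" if "k \<in> L" for k
    using v H_D[OF _ that l0] by (simp add: Hplus_eq)
  obtain j where j: "j \<in> K - L" using False L by blast
  have pos: "0 < \<xi> l0 v"
  proof (rule ccontr)
    assume np: "\<not> 0 < \<xi> l0 v"
    have "\<xi> k v \<le> 0" if "k \<in> K" for k
      using lt[of k] eq[of k] that np by (cases "k \<in> L") auto
    then have "v = 0" by (rule definite)
    then show False using lt[OF j] j l0 L xi_zero by auto
  qed
  define u where "u = (1 / \<xi> l0 v) *\<^sub>R v"
  have xu: "\<xi> k u = \<xi> k v / \<xi> l0 v" if "k \<in> K" for k using that by (simp add: u_def xi_scale)
  have one: "\<xi> k u = 1 \<longleftrightarrow> k \<in> L" if "k \<in> K" for k
    using xu[OF that] pos lt[of k] eq[of k] that by (cases "k \<in> L") (auto simp: field_simps)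
  have le: "\<xi> k u \<le> 1" if "k \<in> K" for k
    using pos lt[of k] eq[of k] that by (cases "k \<in> L") (simp_all add: xu less_imp_le)
  have l0K: "l0 \<in> K" using l0 L by blast
  have "nu K \<xi> u = 1"
  proof (rule antisym)
    show "nu K \<xi> u \<le> 1" using le finite_K K_nonempty by (intro nu_on_leI)
    show "1 \<le> nu K \<xi> u" using nu_on_ge[OF finite_K l0K, of \<xi> u] one[OF l0K] l0 by auto
  qed
  moreover have "L = {k\<in>K. \<xi> k u = 1}" using one L by blast
  ultimately show ?thesis using L by (auto simp: dual_faces_def)
qed simp

text \<open>
  With \<open>z l\<close> representing the functional \<open>\<xi> l - \<xi> l\<^sub>0\<close>, the kernel of
  \<open>F u = (\<Sum>l\<in>L. (z l \<bullet> u) *\<^sub>R z l)\<close> is \<open>H \<xi> L\<close>, because \<open>F u \<bullet> u = (\<Sum>l\<in>L. (z l \<bullet> u)\<^sup>2)\<close>. The vectors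
  \<open>e l\<close> are the images of the \<open>z l\<close> under a generalized inverse of \<open>F\<close>.
\<close>

lemma projection_along_H:
  assumes L: "L \<subseteq> K" and l0: "l0 \<in> L"
  obtains e where "\<And>u. u - (\<Sum>l\<in>L. (\<xi> l u - \<xi> l0 u) *\<^sub>R e l) \<in> H \<xi> L"
proof -
  define z where "z l = (\<Sum>b\<in>Basis. (\<xi> l b - \<xi> l0 b) *\<^sub>R b)" for l
  have fin: "finite L" using L finite_K finite_subset by blast
  have z: "z l \<bullet> u = \<xi> l u - \<xi> l0 u" if "l \<in> L" for l u
  proof -
    have *: "linear (\<lambda>u. \<xi> l u - \<xi> l0 u)"
      using linear that l0 L by (intro linear_compose_sub) auto
    show ?thesis
      using Linear_Algebra.linear_componentwise[OF *, of u 1]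
      by (simp add: z_def inner_sum_left inner_commute[of u] mult.commute)
  qed
  define F where "F u = (\<Sum>l\<in>L. (z l \<bullet> u) *\<^sub>R z l)" for u
  have linF: "linear F"
    unfolding F_def by (intro linear_compose_sum ballI)
      (auto intro!: linearI simp: inner_add_right algebra_simps)
  obtain g where g: "linear g" "\<And>v. v \<in> range F \<Longrightarrow> F (g v) = v"
    using linear_exists_right_inverse_on[OF linF subspace_UNIV] by auto
  have ker: "u \<in> H \<xi> L" if "F u = 0" for u
  proof -
    have "0 = F u \<bullet> u" using that by simp
    also have "\<dots> = (\<Sum>l\<in>L. (z l \<bullet> u)\<^sup>2)"
      by (simp add: F_def inner_sum_left power2_eq_square)
    finally have "\<forall>l\<in>L. (z l \<bullet> u)\<^sup>2 = 0"
      using fin by (simp add: sum_nonneg_eq_0_iff)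
    then have "\<xi> l u = \<xi> l0 u" if "l \<in> L" for l using z[OF that, of u] that by auto
    then show ?thesis by (intro H_I) simp
  qed
  show thesis
  proof (rule that[of "\<lambda>l. g (z l)"])
    fix u
    have "(\<Sum>l\<in>L. (\<xi> l u - \<xi> l0 u) *\<^sub>R g (z l)) = g (F u)"
      using z g(1) by (simp add: F_def linear_sum linear_cmul)
    moreover have "F (u - g (F u)) = 0" using linF g(2) by (simp add: linear_diff)
    ultimately show "u - (\<Sum>l\<in>L. (\<xi> l u - \<xi> l0 u) *\<^sub>R g (z l)) \<in> H \<xi> L"
      using ker by simp
  qed
qed

text \<open>The correction term of \<open>projection_along_H\<close> is linear in the differences of
  the functionals, so its size is controlled by \<open>M\<close> with a constant independent of
  \<open>u\<close>.\<close>

lemma distance_to_H: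
  assumes L: "L \<subseteq> K" "L \<noteq> {}"
  obtains E where "0 < E" "\<And>u M. (\<And>k l. k \<in> L \<Longrightarrow> l \<in> L \<Longrightarrow> \<bar>\<xi> k u - \<xi> l u\<bar> \<le> M) \<Longrightarrow>
    \<exists>h\<in>H \<xi> L. norm (u - h) \<le> E * M"
proof -
  obtain l0 where l0: "l0 \<in> L" using L by blast
  obtain e where e: "\<And>u. u - (\<Sum>l\<in>L. (\<xi> l u - \<xi> l0 u) *\<^sub>R e l) \<in> H \<xi> L"
    using projection_along_H[OF L(1) l0] by blast
  have S: "0 \<le> (\<Sum>l\<in>L. norm (e l))" by (simp add: sum_nonneg)
  show thesis
  proof (rule that[of "1 + (\<Sum>l\<in>L. norm (e l))"])
    show "0 < 1 + (\<Sum>l\<in>L. norm (e l))" using S by linarith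
    fix u M assume M: "\<And>k l. k \<in> L \<Longrightarrow> l \<in> L \<Longrightarrow> \<bar>\<xi> k u - \<xi> l u\<bar> \<le> M"
    have "0 \<le> M" using M[OF l0 l0] by simp
    have "norm (\<Sum>l\<in>L. (\<xi> l u - \<xi> l0 u) *\<^sub>R e l) \<le> (\<Sum>l\<in>L. M * norm (e l))"
      using M l0 by (intro sum_norm_le) (auto intro: mult_right_mono)
    also have "\<dots> \<le> (1 + (\<Sum>l\<in>L. norm (e l))) * M"
      using \<open>0 \<le> M\<close> by (simp add: algebra_simps sum_distrib_left)
    finally show "\<exists>h\<in>H \<xi> L. norm (u - h) \<le> (1 + (\<Sum>l\<in>L. norm (e l))) * M"
      by (intro bexI[OF _ e[of u]]) simp
  qed
qed

section \<open>Horofunctions, their invariance under \<open>H\<close>, and their values at the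
  probes \<open>- (t *\<^sub>R w k)\<close>\<close>

lemma nu_on_add_H:
  assumes "L \<subseteq> K" "h \<in> H \<xi> L" "l \<in> L"
  shows "nu_on \<xi> L (u + h) = nu_on \<xi> L u + \<xi> l h"
proof -
  have fin: "finite L" using assms finite_K finite_subset by blast
  have eq: "\<xi> k (u + h) = \<xi> k u + \<xi> l h" if "k \<in> L" for k
    using H_D[OF assms(2) that assms(3)] that assms(1) by (auto simp: xi_add subset_iff)
  have "nu_on \<xi> L (u + h) = Max ((\<lambda>k. \<xi> k u + \<xi> l h) ` L)"
    unfolding nu_on_def using eq by (intro arg_cong[of _ _ Max] image_cong) auto
  also have "\<dots> = nu_on \<xi> L u + \<xi> l h"
    unfolding nu_on_def using Max_add_commute[OF fin, of "\<lambda>k. \<xi> k u"] assms by auto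
  finally show ?thesis .
qed

text \<open>Adding an element of \<open>H \<xi> L\<close> shifts both maxima by the same number,
  which cancels in the difference.\<close>

lemma horo_add_H:
  assumes "L \<subseteq> K" "L \<noteq> {}" "h \<in> H \<xi> L"
  shows "horo \<xi> L (p + h) = horo \<xi> L p"
proof
  fix v
  obtain l where l: "l \<in> L" using assms by blast
  have "p + h - v = p - v + h" by simp
  then show "horo \<xi> L (p + h) v = horo \<xi> L p v"
    using nu_on_add_H[OF assms(1,3) l] by (simp only: horo_def)
qed

lemma nu_on_lipschitz:
  assumes C: "\<And>k u. k \<in> K \<Longrightarrow> \<bar>\<xi> k u\<bar> \<le> C * norm u" and L: "L \<subseteq> K" "L \<noteq> {}"
  shows "\<bar>nu_on \<xi> L u - nu_on \<xi> L v\<bar> \<le> C * norm (u - v)"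
proof -
  have fin: "finite L" using L finite_K finite_subset by blast
  have *: "nu_on \<xi> L x \<le> nu_on \<xi> L y + C * norm (x - y)" for x y
  proof (rule nu_on_leI[OF fin L(2)])
    fix l assume l: "l \<in> L"
    then have "\<xi> l x - \<xi> l y \<le> C * norm (x - y)"
      using C[of l "x - y"] L by (auto simp: xi_diff)
    then show "\<xi> l x \<le> nu_on \<xi> L y + C * norm (x - y)"
      using nu_on_ge[OF fin l, of \<xi> y] by linarith
  qed
  show ?thesis using *[of u v] *[of v u] by (simp add: norm_minus_commute abs_le_iff)
qed

lemma horo_based: assumes "L \<subseteq> K" "L \<noteq> {}" shows "horo \<xi> L p \<in> based_functions"
proof -
  obtain C where C: "0 < C" "\<And>k u. k \<in> K \<Longrightarrow> \<bar>\<xi> k u\<bar> \<le> C * norm u"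
    using xi_bound by blast
  have "C-lipschitz_on UNIV (horo \<xi> L p)"
    using nu_on_lipschitz[OF C(2) assms, of "p - _" "p - _"] C(1)
    by (auto simp: lipschitz_on_def horo_def dist_real_def dist_norm norm_minus_commute)
  then show ?thesis
    by (auto simp: based_functions_def lipschitz_on_continuous_on) (simp add: horo_def)
qed

text \<open>
  In the direction \<open>- w k\<close> all functionals except \<open>\<xi> k\<close> grow with rate at most \<open>1 - \<eta>\<close>, so the
  values of a horofunction there reveal whether \<open>k \<in> L\<close> and the offset \<open>\<xi> k p - nu_on \<xi> L p\<close>.
\<close>

lemma horo_peak_ge:
  assumes "L \<subseteq> K" "k \<in> L"
  shows "\<xi> k p - nu_on \<xi> L p + t \<le> horo \<xi> L p (- (t *\<^sub>R w k))"
proof -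
  have "finite L" using assms finite_K finite_subset by blast
  moreover have "k \<in> K" using assms by blast
  ultimately show ?thesis
    using nu_on_ge[of L k \<xi> "p + t *\<^sub>R w k"] assms peak[of k] by (simp add: horo_def xi_simps)
qed

lemma horo_peak:
  assumes L: "L \<subseteq> K" "L \<noteq> {}" and k: "k \<in> K" and "0 \<le> t"
    and gt: "t * (1 - \<eta>) < horo \<xi> L p (- (t *\<^sub>R w k))"
  shows "k \<in> L" "horo \<xi> L p (- (t *\<^sub>R w k)) = \<xi> k p - nu_on \<xi> L p + t"
proof -
  have fin: "finite L" using L finite_K finite_subset by blast
  obtain l where l: "l \<in> L" "nu_on \<xi> L (p + t *\<^sub>R w k) = \<xi> l (p + t *\<^sub>R w k)"
    using nu_on_attained[OF fin L(2), of \<xi> "p + t *\<^sub>R w k"] by blast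
  have h: "horo \<xi> L p (- (t *\<^sub>R w k)) = \<xi> l p - nu_on \<xi> L p + t * \<xi> l (w k)"
    using l L by (auto simp: horo_def xi_simps subset_iff)
  have "l = k"
  proof (rule ccontr)
    assume "l \<noteq> k"
    then have "t * \<xi> l (w k) \<le> t * (1 - \<eta>)"
      using off_peak[of l k] l(1) L k \<open>0 \<le> t\<close> by (intro mult_left_mono) auto
    then show False using gt h nu_on_ge[OF fin l(1), of \<xi> p] by linarith
  qed
  then show "k \<in> L" "horo \<xi> L p (- (t *\<^sub>R w k)) = \<xi> k p - nu_on \<xi> L p + t"
    using l(1) h peak[OF k] by auto
qed

lemma offset_bound:
  assumes C: "\<And>k u. k \<in> K \<Longrightarrow> \<bar>\<xi> k u\<bar> \<le> C * norm u" and L: "L \<subseteq> K" and l: "l \<in> L"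
  shows "- (2 * C * norm p) \<le> \<xi> l p - nu_on \<xi> L p"
proof -
  have fin: "finite L" using L finite_K finite_subset by blast
  have "nu_on \<xi> L p \<le> C * norm p"
    using C[of _ p] L l by (intro nu_on_leI[OF fin]) (force simp: abs_le_iff)+
  then show ?thesis using C[of l p] l L by (auto simp: abs_le_iff)
qed

lemma horo_eq_imp:
  assumes L: "L \<subseteq> K" "L \<noteq> {}" "L' \<subseteq> K" "L' \<noteq> {}"
    and eq: "horo \<xi> L p = horo \<xi> L' p'" and l: "l \<in> L"
  shows "l \<in> L' \<and> \<xi> l p - nu_on \<xi> L p = \<xi> l p' - nu_on \<xi> L' p'"
proof -
  define a where "a = \<xi> l p - nu_on \<xi> L p"
  \<comment> \<open>Since \<open>t * \<eta>\<close> exceeds \<open>- a\<close>, the value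
    \<open>a + t\<close> lies above the threshold \<open>t * (1 - \<eta>)\<close> of
    \<open>horo_peak\<close>, which can then be applied to both representations.\<close>
  define t where "t = (\<bar>a\<bar> + 1) / \<eta>"
  have t: "0 \<le> t" "t * \<eta> = \<bar>a\<bar> + 1" using eta_pos by (auto simp: t_def)
  have ge: "a + t \<le> horo \<xi> L p (- (t *\<^sub>R w l))"
    using horo_peak_ge[OF L(1) l] by (simp add: a_def)
  have "t * (1 - \<eta>) < horo \<xi> L p (- (t *\<^sub>R w l))"
    using ge t(2) by (simp add: algebra_simps)
  moreover have "l \<in> K" using l L by blast
  ultimately show ?thesis
    using horo_peak[OF L(1,2) _ t(1), of l p] horo_peak[OF L(3,4) _ t(1), of l p'] eq by auto
qed

lemma coset_add_H: assumes L: "L \<subseteq> K" and h: "h \<in> H \<xi> L" shows "coset \<xi> L (p + h) = coset \<xi> L p"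
proof -
  have "x \<in> (+) h ` H \<xi> L" if "x \<in> H \<xi> L" for x
    by (rule image_eqI[of _ _ "x - h"]) (use subspace_diff[OF subspace_H[OF L] that h] in auto)
  moreover have "h + x \<in> H \<xi> L" if "x \<in> H \<xi> L" for x
    using subspace_add[OF subspace_H[OF L] h that] .
  ultimately have "(+) h ` H \<xi> L = H \<xi> L" by blast
  then have "coset \<xi> L p = (+) p ` (+) h ` H \<xi> L" by (simp add: coset_def)
  then show ?thesis by (simp add: coset_def image_image add.assoc)
qed

text \<open>By \<open>horo_eq_imp\<close> in both directions the index sets agree. Equal offsets
  mean that all functionals in \<open>L\<close> take the same value at \<open>p' - p\<close>, namely
  the difference of the two maxima.\<close>

lemma horo_inj:
  assumes L: "L \<subseteq> K" "L \<noteq> {}" "L' \<subseteq> K" "L' \<noteq> {}" and eq: "horo \<xi> L p = horo \<xi> L' p'"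
  shows "L = L'" "coset \<xi> L p = coset \<xi> L' p'"
proof -
  note 1 = horo_eq_imp[OF L eq] and 2 = horo_eq_imp[OF L(3,4,1,2) eq[symmetric]]
  show "L = L'" using 1 2 by blast
  have "\<xi> k (p' - p) = \<xi> l (p' - p)" if "k \<in> L" "l \<in> L" for k l
  proof -
    have "k \<in> K" "l \<in> K" using that L by auto
    then show ?thesis using 1[OF that(1)] 1[OF that(2)] by (simp add: xi_diff)
  qed
  then have "p' - p \<in> H \<xi> L" by (rule H_I)
  then show "coset \<xi> L p = coset \<xi> L' p'"
    using coset_add_H[OF L(1), of "p' - p" p] \<open>L = L'\<close> by simp
qed

section \<open>The disjoint union of quotients and the sets \<open>U\<close>\<close>

lemma coset_K: "coset \<xi> K p = {p}"
  by (simp add: coset_def H_K)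

lemma quotient_union_eq: "quotient_union K \<xi> = (SIGMA L:faces. range (coset \<xi> L))"
  by (auto simp: quotient_union_def coset_K[abs_def])

text \<open>Treats \<open>K\<close> and the dual faces alike: the singletons are cosets of
  \<open>H \<xi> K\<close>, and enlarging \<open>D\<close> by \<open>H \<xi> L'\<close> changes no
  coset. For \<open>L = K\<close> the only face above \<open>L\<close> is \<open>K\<close>
  itself.\<close>

lemma U_eq:
  assumes L: "L \<in> faces"
  shows "U K \<xi> L \<epsilon> q = {(L', coset \<xi> L' (q + b + h)) | L' b h.
    L' \<in> faces \<and> L \<subseteq> L' \<and> norm b < \<epsilon> \<and> h \<in> Hplus K \<xi> L}" (is "_ = ?R")
proof (cases "L = K")
  case True
  have "L' = K" if "L' \<in> faces" "K \<subseteq> L'" for L' using facesD(1)[OF that(1)] that by blast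
  then have "?R = {(K, {q + b}) | b. norm b < \<epsilon>}"
    unfolding True Hplus_def by (force simp: coset_K)
  also have "\<dots> = U K \<xi> L \<epsilon> q" using True by (auto simp: U_def)
  finally show ?thesis ..
next
  case False
  define D where "D = {q + b + h | b h. b \<in> ball 0 \<epsilon> \<and> h \<in> Hplus K \<xi> L}"
  have LK: "L \<subseteq> K" using facesD(1)[OF L] .
  define E where "E L' = {d + h | d h. d \<in> D \<and> h \<in> H \<xi> L'}" for L'
  have E: "coset \<xi> L' ` E L' = coset \<xi> L' ` D" if L': "L' \<in> faces" for L'
  proof -
    have c: "coset \<xi> L' (d + h) = coset \<xi> L' d" if "h \<in> H \<xi> L'" for d h
      using coset_add_H[OF facesD(1)[OF L'] that] .
    have "d + 0 \<in> E L'" if "d \<in> D" for d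
      using that subspace_0[OF subspace_H[OF facesD(1)[OF L']]] unfolding E_def by blast
    then have "D \<subseteq> E L'" by auto
    moreover have "coset \<xi> L' x \<in> coset \<xi> L' ` D" if "x \<in> E L'" for x
      using that c unfolding E_def by blast
    ultimately show ?thesis by blast
  qed
  have "U K \<xi> L \<epsilon> q = {K} \<times> (\<lambda>v. {v}) ` D \<union>
      (SIGMA L':{L' \<in> dual_faces K \<xi>. L \<subseteq> L'}. coset \<xi> L' ` E L')"
    using False by (simp add: U_def Let_def D_def E_def)
  also have "\<dots> = {K} \<times> coset \<xi> K ` D \<union>
      (SIGMA L':{L' \<in> dual_faces K \<xi>. L \<subseteq> L'}. coset \<xi> L' ` D)"
    using E by (auto simp: coset_K)
  also have "\<dots> = (SIGMA L':{L' \<in> faces. L \<subseteq> L'}. coset \<xi> L' ` D)"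
    using LK by blast
  also have "\<dots> = ?R"
  proof (intro subset_antisym subsetI)
    fix x assume "x \<in> (SIGMA L':{L' \<in> faces. L \<subseteq> L'}. coset \<xi> L' ` D)"
    then obtain L' d where "x = (L', coset \<xi> L' d)" "L' \<in> faces" "L \<subseteq> L'" "d \<in> D" by blast
    then show "x \<in> ?R" unfolding D_def mem_ball dist_0_norm by blast
  next
    fix x assume "x \<in> ?R"
    then obtain L' b h where "x = (L', coset \<xi> L' (q + b + h))" "L' \<in> faces" "L \<subseteq> L'"
      "norm b < \<epsilon>" "h \<in> Hplus K \<xi> L" by blast
    moreover from this have "q + b + h \<in> D" unfolding D_def mem_ball dist_0_norm by blast
    ultimately show "x \<in> (SIGMA L':{L' \<in> faces. L \<subseteq> L'}. coset \<xi> L' ` D)" by blast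
  qed
  finally show ?thesis .
qed

section \<open>Comparison of the sets \<open>U\<close> with uniform neighborhoods of a
  horofunction\<close>

lemma U_subset_horo_neighborhood:
  assumes L: "L \<in> faces" and "0 < e" "0 \<le> R"
  obtains q \<epsilon> where "q \<in> Hplus K \<xi> L" "0 < \<epsilon>"
    "\<And>L' b h v. L' \<in> faces \<Longrightarrow> L \<subseteq> L' \<Longrightarrow> norm b < \<epsilon> \<Longrightarrow> h \<in> Hplus K \<xi> L \<Longrightarrow> norm v \<le> R \<Longrightarrow>
      \<bar>horo \<xi> L' (p + q + b + h) v - horo \<xi> L p v\<bar> < e"
proof -
  note LK = facesD[OF L]
  obtain C where C: "0 < C" "\<And>k u. k \<in> K \<Longrightarrow> \<bar>\<xi> k u\<bar> \<le> C * norm u" using xi_bound by blast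
  obtain h0 where h0: "h0 \<in> Hplus K \<xi> L" using Hplus_nonempty[OF L] by blast
  obtain c where c: "0 < c" "\<And>l k. l \<in> L \<Longrightarrow> k \<in> K - L \<Longrightarrow> c \<le> \<xi> l h0 - \<xi> k h0"
    using Hplus_gap[OF LK(1) h0] by blast
  \<comment> \<open>The gap \<open>t * c\<close> absorbs the values of two functionals at
    \<open>p + b - v\<close>, each at most \<open>C * (norm p + R + 1)\<close> in absolute value
    because \<open>norm b < 1\<close>.\<close>
  define t where "t = (2 * C * (norm p + R + 1)) / c"
  have tpos: "0 < t" using C c \<open>0 \<le> R\<close> by (auto simp: t_def add_nonneg_pos)
  have tc: "t * c = 2 * (C * (norm p + R + 1))" using c by (simp add: t_def)
  show thesis
  \<comment> \<open>The bound 1 on \<open>norm b\<close> is the one used for \<open>t\<close>. The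
    other bound pays for two Lipschitz estimates, each costing \<open>C * norm b\<close>.\<close>
  proof (rule that[of "t *\<^sub>R h0" "min 1 (e / (2 * C))"])
    show "t *\<^sub>R h0 \<in> Hplus K \<xi> L" using Hplus_scale[OF LK(1) h0 tpos] .
    show "0 < min 1 (e / (2 * C))" using C \<open>0 < e\<close> by simp
    fix L' :: "'k set" and b h v :: 'a
    assume L': "L' \<in> faces" "L \<subseteq> L'" and b: "norm b < min 1 (e / (2 * C))"
      and h: "h \<in> Hplus K \<xi> L" and v: "norm v \<le> R"
    define d where "d = p + t *\<^sub>R h0 + b + h"
    have nu: "nu_on \<xi> L' (d - v) = nu_on \<xi> L (d - v)" if v: "norm v \<le> R" for v
    proof (rule nu_on_dominated[OF facesD(3)[OF L'(1)] L'(2) LK(2)])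
      fix k assume k: "k \<in> L' - L"
      obtain l where l: "l \<in> L" using LK by blast
      have lk: "l \<in> K" "k \<in> K" using l k LK facesD[OF L'(1)] by auto
      have "norm (p + b - v) \<le> norm p + norm b + norm v" by (smt (verit) norm_triangle_ineq norm_triangle_ineq4)
      then have "norm (p + b - v) \<le> norm p + R + 1" using b v by simp
      then have "C * norm (p + b - v) \<le> C * (norm p + R + 1)" using C by (intro mult_left_mono) auto
      moreover have "\<bar>\<xi> l (p + b - v)\<bar> \<le> C * norm (p + b - v)" "\<bar>\<xi> k (p + b - v)\<bar> \<le> C * norm (p + b - v)"
        using C lk by auto
      moreover have "t * c \<le> t * (\<xi> l h0 - \<xi> k h0)"
        using c(2)[OF l, of k] k lk tpos by (intro mult_left_mono) auto
      moreover have "\<xi> k h < \<xi> l h" using h l k lk by (auto simp: Hplus_eq)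
      ultimately have "\<xi> k (p + b - v) + t * \<xi> k h0 + \<xi> k h \<le> \<xi> l (p + b - v) + t * \<xi> l h0 + \<xi> l h"
        unfolding right_diff_distrib using tc by linarith
      then have "\<xi> k (d - v) \<le> \<xi> l (d - v)" using lk by (simp add: d_def xi_simps)
      then show "\<exists>l\<in>L. \<xi> k (d - v) \<le> \<xi> l (d - v)" using l by blast
    qed
    \<comment> \<open>The maxima over \<open>L'\<close> and \<open>L\<close> agree both at
      \<open>v\<close> and at the base point 0. The part in \<open>H \<xi> L\<close> then drops out,
      so that only the perturbation \<open>b\<close> remains.\<close>
    have "horo \<xi> L' d v = horo \<xi> L d v"
      using nu[OF v] nu[of 0] \<open>0 \<le> R\<close> by (simp add: horo_def)
    also have "\<dots> = horo \<xi> L (p + b) v"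
    proof -
      have "t *\<^sub>R h0 + h \<in> H \<xi> L"
        using h0 h subspace_H[OF LK(1)] by (auto simp: Hplus_eq intro!: subspace_add subspace_scale)
      then have "horo \<xi> L (p + b + (t *\<^sub>R h0 + h)) = horo \<xi> L (p + b)"
        by (rule horo_add_H[OF LK(1,2)])
      then show ?thesis by (simp add: d_def algebra_simps)
    qed
    finally have eq: "horo \<xi> L' d v = horo \<xi> L (p + b) v" .
    have "\<bar>nu_on \<xi> L (p + b - v) - nu_on \<xi> L (p - v)\<bar> \<le> C * norm b"
      "\<bar>nu_on \<xi> L (p + b) - nu_on \<xi> L p\<bar> \<le> C * norm b"
      using nu_on_lipschitz[OF C(2) LK(1,2), of "p + b - v" "p - v"]
        nu_on_lipschitz[OF C(2) LK(1,2), of "p + b" p] by auto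
    moreover have "2 * (C * norm b) < e" using b C by (simp add: field_simps)
    ultimately have "\<bar>horo \<xi> L (p + b) v - horo \<xi> L p v\<bar> < e" unfolding horo_def by linarith
    then show "\<bar>horo \<xi> L' (p + t *\<^sub>R h0 + b + h) v - horo \<xi> L p v\<bar> < e"
      using eq by (simp add: d_def)
  qed
qed

text \<open>Probing along every \<open>- w k\<close> yields \<open>L \<subseteq> L'\<close>, offsets
  on \<open>L\<close> close to those of \<open>p\<close>, and very negative offsets on
  \<open>L' - L\<close>. Modulo \<open>H \<xi> L'\<close>, the point \<open>p'\<close> then splits
  as \<open>p + q + s + y\<close> with \<open>s\<close> small and \<open>y\<close> in the cone of
  \<open>L\<close>.\<close>

lemma horo_neighborhood_subset_U:
  assumes L: "L \<in> faces" and q: "q \<in> H \<xi> L" and "0 < \<epsilon>"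
  obtains R e where "0 < e"
    "\<And>L' p'. L' \<in> faces \<Longrightarrow> (\<And>v. norm v \<le> R \<Longrightarrow> \<bar>horo \<xi> L' p' v - horo \<xi> L p v\<bar> < e) \<Longrightarrow>
      (L', coset \<xi> L' p') \<in> U K \<xi> L \<epsilon> (p + q)"
proof -
  note LK = facesD[OF L]
  obtain C where C: "0 < C" "\<And>k u. k \<in> K \<Longrightarrow> \<bar>\<xi> k u\<bar> \<le> C * norm u" using xi_bound by blast
  obtain W where W: "0 < W" "\<And>k. k \<in> K \<Longrightarrow> norm (w k) \<le> W" using w_bound by blast
  obtain E where E: "0 < E" "\<And>u M. (\<And>k l. k \<in> L \<Longrightarrow> l \<in> L \<Longrightarrow> \<bar>\<xi> k u - \<xi> l u\<bar> \<le> M) \<Longrightarrow>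
    \<exists>h\<in>H \<xi> L. norm (u - h) \<le> E * M" using distance_to_H[OF LK(1,2)] by blast
  define e where "e = min 1 (\<epsilon> / (3 * E))"
  have e: "0 < e" "e \<le> 1" "E * (2 * e) < \<epsilon>"
  proof -
    show "0 < e" "e \<le> 1" using E \<open>0 < \<epsilon>\<close> by (auto simp: e_def)
    have "E * e \<le> \<epsilon> / 3" using E by (simp add: e_def min_def field_simps)
    then show "E * (2 * e) < \<epsilon>" using \<open>0 < \<epsilon>\<close> by simp
  qed
  define A where "A = 2 * C * norm p"
  define A' where "A' = C * (norm p + \<epsilon> + norm q)"
  have A: "0 \<le> A" "0 \<le> A'" using C \<open>0 < \<epsilon>\<close> by (auto simp: A_def A'_def)
  \<comment> \<open>Here \<open>A\<close> bounds \<open>- \<alpha> l\<close> on \<open>L\<close>,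
    and \<open>A'\<close> bounds every functional at \<open>p + s + q\<close>. In the final
    comparison \<open>2 * A'\<close> pays for two such values, and 3 beats the two errors
    \<open>e \<le> 1\<close>.\<close>
  define t where "t = (A + 3 + 2 * A') / \<eta>"
  have t: "0 \<le> t" "t * \<eta> = A + 3 + 2 * A'" using eta_pos A by (auto simp: t_def)
  show thesis
  proof (rule that[OF e(1), of "t * W"])
    fix L' p'
    assume L': "L' \<in> faces"
      and close: "\<And>v. norm v \<le> t * W \<Longrightarrow> \<bar>horo \<xi> L' p' v - horo \<xi> L p v\<bar> < e"
    note L'K = facesD[OF L']
    define \<alpha> where "\<alpha> l = \<xi> l p - nu_on \<xi> L p" for l
    define a where "a l = \<xi> l p' - nu_on \<xi> L' p'" for l
    have \<alpha>: "- A \<le> \<alpha> l" if "l \<in> L" for l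
      using offset_bound[OF C(2) LK(1) that, of p] by (simp add: \<alpha>_def A_def)
    have cl: "\<bar>horo \<xi> L' p' (- (t *\<^sub>R w k)) - horo \<xi> L p (- (t *\<^sub>R w k))\<bar> < e" if "k \<in> K" for k
      using W(2)[OF that] t by (intro close) (auto intro: mult_left_mono)
    have inL: "l \<in> L' \<and> \<bar>a l - \<alpha> l\<bar> < e" if l: "l \<in> L" for l
    proof -
      have lK: "l \<in> K" using l LK by blast
      have ge: "\<alpha> l + t \<le> horo \<xi> L p (- (t *\<^sub>R w l))"
        using horo_peak_ge[OF LK(1) l] by (simp add: \<alpha>_def)
      have gt: "t * (1 - \<eta>) < \<alpha> l + t - e"
        using t(2) e(2) A \<alpha>[OF l] by (simp add: algebra_simps)
      have "t * (1 - \<eta>) < horo \<xi> L p (- (t *\<^sub>R w l))" using ge gt e(1) by linarith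
      note 1 = horo_peak[OF LK(1,2) lK t(1) this]
      have "t * (1 - \<eta>) < horo \<xi> L' p' (- (t *\<^sub>R w l))" using ge gt cl[OF lK] by linarith
      note 2 = horo_peak[OF L'K(1,2) lK t(1) this]
      show ?thesis using 1 2 cl[OF lK] by (auto simp: \<alpha>_def a_def)
    qed
    then have LL': "L \<subseteq> L'" by blast
    \<comment> \<open>As \<open>k\<close> is not in \<open>L\<close>, \<open>horo_peak\<close> keeps
      the horofunction of \<open>p\<close> below the threshold at this probe, and closeness
      transfers the bound to \<open>p'\<close>.\<close>
    have notinL: "a k \<le> e - t * \<eta>" if k: "k \<in> L' - L" for k
    proof -
      have kK: "k \<in> K" using k L'K by blast
      have "horo \<xi> L p (- (t *\<^sub>R w k)) \<le> t * (1 - \<eta>)"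
        using horo_peak(1)[OF LK(1,2) kK t(1), of p] k by force
      moreover have "a k + t \<le> horo \<xi> L' p' (- (t *\<^sub>R w k))"
        using horo_peak_ge[OF L'K(1), of k p' t] k by (simp add: a_def)
      ultimately show ?thesis using cl[OF kK] by (simp add: algebra_simps)
    qed
    have "\<bar>\<xi> k (p' - p) - \<xi> l (p' - p)\<bar> \<le> 2 * e" if "k \<in> L" "l \<in> L" for k l
    proof -
      have "\<xi> k (p' - p) - \<xi> l (p' - p) = (a k - \<alpha> k) - (a l - \<alpha> l)"
        using that LK by (auto simp: a_def \<alpha>_def xi_diff subset_iff)
      then show ?thesis using inL[OF that(1)] inL[OF that(2)] by linarith
    qed
    then obtain h where h: "h \<in> H \<xi> L" "norm (p' - p - h) \<le> E * (2 * e)"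
      using E(2)[of "p' - p" "2 * e"] by blast
    define s where "s = p' - p - h"
    have s: "norm s < \<epsilon>" using h e by (simp add: s_def)
    \<comment> \<open>The functionals outside \<open>L'\<close> are not controlled by \<open>close\<close>; a large multiple of some
      \<open>h' \<in> Hplus K \<xi> L'\<close> makes them small without changing the coset of \<open>p'\<close>.\<close>
    obtain h' where h': "h' \<in> Hplus K \<xi> L'" using Hplus_nonempty[OF L'] by blast
    obtain c where c: "0 < c" "\<And>l k. l \<in> L' \<Longrightarrow> k \<in> K - L' \<Longrightarrow> c \<le> \<xi> l h' - \<xi> k h'"
      using Hplus_gap[OF L'K(1) h'] by blast
    \<comment> \<open>\<open>r * c\<close> exceeds every difference of two functionals at
      \<open>h - q\<close>, so \<open>r *\<^sub>R h'\<close> decides the comparison with indices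
      outside \<open>L'\<close>.\<close>
    define r where "r = (2 * (C * norm (h - q)) + 1) / c"
    have r: "0 \<le> r" "r * c = 2 * (C * norm (h - q)) + 1" using c C by (auto simp: r_def)
    define y where "y = h - q + r *\<^sub>R h'"
    have h'H: "h' \<in> H \<xi> L'" using h' by (simp add: Hplus_eq)
    have "y \<in> H \<xi> L"
      using h q h'H H_antimono[OF LL'] subspace_H[OF LK(1)]
      by (auto simp: y_def intro!: subspace_add subspace_diff subspace_scale)
    moreover have "\<xi> k y < \<xi> l y" if l: "l \<in> L" and k: "k \<in> K - L" for l k
    proof -
      have lk: "l \<in> K" "k \<in> K" "l \<in> L'" using l k LK LL' by auto
      have y: "\<xi> l y - \<xi> k y = \<xi> l (h - q) - \<xi> k (h - q) + r * (\<xi> l h' - \<xi> k h')"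
        using lk by (simp add: y_def xi_simps algebra_simps)
      show ?thesis
      proof (cases "k \<in> L'")
        \<comment> \<open>Both indices lie in \<open>L'\<close>, where \<open>h'\<close> contributes
          nothing. The comparison reduces to the offsets \<open>a l\<close> and \<open>a k\<close>,
          up to the bounded values at \<open>x\<close>.\<close>
        case True
        define x where "x = p + s + q"
        have "norm x \<le> norm p + \<epsilon> + norm q"
          using norm_triangle_ineq[of "p + s" q] norm_triangle_ineq[of p s] s by (simp add: x_def)
        then have "C * norm x \<le> A'" using C by (auto simp: A'_def intro: mult_left_mono)
        then have x: "\<bar>\<xi> l x\<bar> \<le> A'" "\<bar>\<xi> k x\<bar> \<le> A'" using C(2)[of _ x] lk by force+
        have "\<xi> l h' = \<xi> k h'" using H_D[OF h'H] lk True by blast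
        moreover have "h - q = p' - x" by (simp add: s_def x_def)
        ultimately have "\<xi> l y - \<xi> k y = a l - a k - (\<xi> l x - \<xi> k x)"
          using y lk by (simp add: xi_diff a_def)
        then show ?thesis
          using x inL[OF l] \<alpha>[OF l] notinL[of k] True k e t(2) A unfolding abs_le_iff abs_less_iff
          by simp
      next
        case False
        then have "r * c \<le> r * (\<xi> l h' - \<xi> k h')"
          using c(2)[of l k] lk r by (intro mult_left_mono) auto
        then show ?thesis
          using r(2) C(2)[of l "h - q"] C(2)[of k "h - q"] lk y by (simp add: abs_le_iff)
      qed
    qed
    ultimately have "y \<in> Hplus K \<xi> L" by (auto simp: Hplus_eq)
    moreover have "coset \<xi> L' p' = coset \<xi> L' (p + q + s + y)"
    proof -
      have "p + q + s + y = p' + r *\<^sub>R h'" by (simp add: s_def y_def)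
      then show ?thesis
        using coset_add_H[OF L'K(1) subspace_scale[OF subspace_H[OF L'K(1)] h'H]] by simp
    qed
    ultimately show "(L', coset \<xi> L' p') \<in> U K \<xi> L \<epsilon> (p + q)"
      unfolding U_eq[OF L] using L' LL' s by blast
  qed
qed


section \<open>The elements of the bordification\<close>

lemma range_horo_K: "{\<lambda>u. delta K \<xi> p u - delta K \<xi> p 0 | p. True} = range (horo \<xi> K)"
  by (auto simp: delta_def horo_def)

lemma horo_in_bordification:
  assumes L: "L \<in> faces" shows "horo \<xi> L p \<in> bordification K \<xi>"
  unfolding bordification_def range_horo_K
proof (rule bounded_convergence_closureI)
  show "range (horo \<xi> K) \<subseteq> based_functions" using horo_based K_nonempty by blast
  show "horo \<xi> L p \<in> based_functions" using horo_based facesD[OF L] by blast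
  fix R e :: real assume "0 \<le> R" "0 < e"
  obtain q \<epsilon> where q: "q \<in> Hplus K \<xi> L" "0 < \<epsilon>"
    "\<And>L' b h v. L' \<in> faces \<Longrightarrow> L \<subseteq> L' \<Longrightarrow> norm b < \<epsilon> \<Longrightarrow> h \<in> Hplus K \<xi> L \<Longrightarrow> norm v \<le> R \<Longrightarrow>
      \<bar>horo \<xi> L' (p + q + b + h) v - horo \<xi> L p v\<bar> < e"
    using U_subset_horo_neighborhood[OF L \<open>0 < e\<close> \<open>0 \<le> R\<close>] by metis
  \<comment> \<open>The cone element \<open>h\<close> is taken to be \<open>q\<close> again, because
    0 need not lie in \<open>Hplus K \<xi> L\<close>.\<close>
  have "\<bar>horo \<xi> K (p + q + 0 + q) v - horo \<xi> L p v\<bar> < e" if "norm v \<le> R" for v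
    using facesD(1)[OF L] q(1,2) that by (intro q(3)) auto
  then show "\<exists>g\<in>range (horo \<xi> K). \<forall>v. norm v \<le> R \<longrightarrow> \<bar>g v - horo \<xi> L p v\<bar> < e"
    by blast
qed

lemma tendsto_xi: "k \<in> K \<Longrightarrow> (f \<longlongrightarrow> x) F \<Longrightarrow> ((\<lambda>n. \<xi> k (f n)) \<longlongrightarrow> \<xi> k x) F"
  using linear bounded_linear.tendsto linear_conv_bounded_linear by blast

lemma tendsto_horo:
  assumes L: "L \<subseteq> K" "L \<noteq> {}" and f: "(f \<longlongrightarrow> p) F"
  shows "((\<lambda>n. horo \<xi> L (f n) v) \<longlongrightarrow> horo \<xi> L p v) F"
proof -
  obtain C where C: "0 < C" "\<And>k u. k \<in> K \<Longrightarrow> \<bar>\<xi> k u\<bar> \<le> C * norm u" using xi_bound by blast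
  have "C-lipschitz_on UNIV (nu_on \<xi> L)"
    using nu_on_lipschitz[OF C(2) L] C(1) by (auto simp: lipschitz_on_def dist_real_def dist_norm)
  then have cont: "continuous_on UNIV (nu_on \<xi> L)" by (rule lipschitz_on_continuous_on)
  have nu_lim: "((\<lambda>n. nu_on \<xi> L (g n)) \<longlongrightarrow> nu_on \<xi> L x) F" if "(g \<longlongrightarrow> x) F" for g x
    using continuous_on_tendsto_compose[OF cont that] by simp
  show ?thesis unfolding horo_def by (intro tendsto_diff nu_lim f tendsto_const)
qed

text \<open>
  Let \<open>horo \<xi> K (P n)\<close> converge to \<open>f\<close>. By the peak property the offsets \<open>\<xi> k (P n) - nu K \<xi> (P n)\<close>
  converge for \<open>k\<close> in some \<open>L\<close> and tend to \<open>-\<infinity>\<close> for the other \<open>k\<close>, without passing to a subsequence.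
  The components of the \<open>P n\<close> transversal to \<open>H \<xi> L\<close> then converge to a point \<open>p\<close> with
  \<open>f = horo \<xi> L p\<close>, and the components in \<open>H \<xi> L\<close> eventually lie in \<open>Hplus K \<xi> L\<close>.
\<close>

lemma horo_limit:
  assumes f: "\<And>v. (\<lambda>n. horo \<xi> K (P n) v) \<longlonglongrightarrow> f v"
  obtains L p where "L \<in> faces" "f = horo \<xi> L p"
proof -
  define a where "a k n = \<xi> k (P n) - nu K \<xi> (P n)" for k n
  \<comment> \<open>These are the indices for which the limit passes the test of
    \<open>horo_peak\<close> at some distance \<open>t\<close>. A strict inequality for
    \<open>f\<close> is inherited by \<open>horo \<xi> K (P n)\<close> for large
    \<open>n\<close>.\<close>
  define L where "L = {k\<in>K. \<exists>t\<ge>0. t * (1 - \<eta>) < f (- (t *\<^sub>R w k))}"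
  have L: "L \<subseteq> K" by (auto simp: L_def)
  then have finL: "finite L" using finite_K finite_subset by blast
  have "\<exists>c. a k \<longlonglongrightarrow> c" if k: "k \<in> L" for k
  proof -
    obtain t where t: "k \<in> K" "0 \<le> t" "t * (1 - \<eta>) < f (- (t *\<^sub>R w k))"
      using k by (auto simp: L_def)
    have "\<forall>\<^sub>F n in sequentially. t * (1 - \<eta>) < horo \<xi> K (P n) (- (t *\<^sub>R w k))"
      using order_tendstoD(1)[OF f t(3)] .
    then have "\<forall>\<^sub>F n in sequentially. horo \<xi> K (P n) (- (t *\<^sub>R w k)) - t = a k n"
    proof eventually_elim
      case (elim n)
      show ?case using horo_peak(2)[OF order_refl K_nonempty t(1,2) elim] by (simp add: a_def)
    qed
    moreover have "(\<lambda>n. horo \<xi> K (P n) (- (t *\<^sub>R w k)) - t) \<longlonglongrightarrow> f (- (t *\<^sub>R w k)) - t"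
      by (intro tendsto_diff f tendsto_const)
    ultimately show ?thesis using Lim_transform_eventually by blast
  qed
  then obtain c where c: "\<And>k. k \<in> L \<Longrightarrow> a k \<longlonglongrightarrow> c k" by metis
  have low: "\<forall>\<^sub>F n in sequentially. a k n \<le> Z" if k: "k \<in> K - L" for k Z
  proof -
    \<comment> \<open>A failed test at this \<open>t\<close> forces
      \<open>a k n < 1 - t * \<eta> = - \<bar>Z\<bar>\<close> eventually.\<close>
    define t where "t = (\<bar>Z\<bar> + 1) / \<eta>"
    have t: "0 \<le> t" "t * \<eta> = \<bar>Z\<bar> + 1" using eta_pos by (auto simp: t_def)
    have "f (- (t *\<^sub>R w k)) \<le> t * (1 - \<eta>)" using k t(1) by (auto simp: L_def not_less)
    then have "f (- (t *\<^sub>R w k)) < t * (1 - \<eta>) + 1" by linarith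
    from order_tendstoD(2)[OF f this] show ?thesis
    proof eventually_elim
      case (elim n)
      moreover have "a k n + t \<le> horo \<xi> K (P n) (- (t *\<^sub>R w k))"
        using horo_peak_ge[OF order_refl, of k "P n" t] k by (simp add: a_def)
      ultimately have "a k n + t < t * (1 - \<eta>) + 1" by linarith
      then show ?case using t(2) by (simp add: algebra_simps)
    qed
  qed
  have "L \<noteq> {}"
  proof
    assume "L = {}"
    then have "\<forall>\<^sub>F n in sequentially. \<forall>k\<in>K. a k n \<le> - 1"
      using low finite_K by (intro eventually_ball_finite) auto
    then obtain n where n: "\<forall>k\<in>K. a k n \<le> - 1" using eventually_happens' by force
    \<comment> \<open>The maximum is attained, so for each \<open>n\<close> some offset is
      0.\<close>
    obtain k where "k \<in> K" "nu K \<xi> (P n) = \<xi> k (P n)"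
      using nu_on_attained[OF finite_K K_nonempty, of \<xi> "P n"] by blast
    then show False using n by (auto simp: a_def)
  qed
  then obtain l0 where l0: "l0 \<in> L" by blast
  obtain e where e: "\<And>u. u - (\<Sum>l\<in>L. (\<xi> l u - \<xi> l0 u) *\<^sub>R e l) \<in> H \<xi> L"
    using projection_along_H[OF L l0] by blast
  define s where "s n = (\<Sum>l\<in>L. (\<xi> l (P n) - \<xi> l0 (P n)) *\<^sub>R e l)" for n
  define p where "p = (\<Sum>l\<in>L. (c l - c l0) *\<^sub>R e l)"
  \<comment> \<open>The common term \<open>nu K \<xi> (P n)\<close> cancels, so the coefficients are
    differences of convergent offsets.\<close>
  have "s = (\<lambda>n. \<Sum>l\<in>L. (a l n - a l0 n) *\<^sub>R e l)" by (auto simp: s_def a_def)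
  then have s: "s \<longlonglongrightarrow> p"
    using c l0 by (auto simp: p_def intro!: tendsto_sum tendsto_scaleR tendsto_diff)
  have h: "P n - s n \<in> H \<xi> L" for n using e[of "P n"] by (simp add: s_def)
  have gap: "\<forall>\<^sub>F n in sequentially. Z < \<xi> l (P n) - \<xi> k (P n)"
    if l: "l \<in> L" and k: "k \<in> K - L" for l k Z
  proof -
    have "\<forall>\<^sub>F n in sequentially. c l - 1 < a l n" using c[OF l] by (rule order_tendstoD) simp
    with low[OF k, of "c l - 1 - Z"] show ?thesis by eventually_elim (simp add: a_def)
  qed
  have "\<forall>\<^sub>F n in sequentially. \<forall>l\<in>L. \<forall>k\<in>K - L. \<xi> k (P n - s n) < \<xi> l (P n - s n)"
  proof (intro eventually_ball_finite ballI finL)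
    show "finite (K - L)" using finite_K by simp
    fix l k assume l: "l \<in> L" and k: "k \<in> K - L"
    have lk: "l \<in> K" "k \<in> K" using l k L by auto
    have "(\<lambda>n. \<xi> l (s n) - \<xi> k (s n)) \<longlonglongrightarrow> \<xi> l p - \<xi> k p"
      using s lk by (intro tendsto_diff tendsto_xi)
    then have "\<forall>\<^sub>F n in sequentially. \<xi> l (s n) - \<xi> k (s n) < \<xi> l p - \<xi> k p + 1"
      by (rule order_tendstoD) simp
    with gap[OF l k, of "\<xi> l p - \<xi> k p + 1"]
    show "\<forall>\<^sub>F n in sequentially. \<xi> k (P n - s n) < \<xi> l (P n - s n)"
      by eventually_elim (use lk in \<open>simp add: xi_diff\<close>)
  qed
  then obtain n where "\<forall>l\<in>L. \<forall>k\<in>K - L. \<xi> k (P n - s n) < \<xi> l (P n - s n)"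
    using eventually_happens' by force
  then have "P n - s n \<in> Hplus K \<xi> L" using h by (simp add: Hplus_eq)
  then have face: "L \<in> faces" by (rule Hplus_imp_face[OF L \<open>L \<noteq> {}\<close>])
  have ev: "\<forall>\<^sub>F n in sequentially. nu K \<xi> (P n - v) = nu_on \<xi> L (P n - v)" for v
  proof -
    have "\<forall>\<^sub>F n in sequentially. \<forall>k\<in>K - L. \<xi> l0 v - \<xi> k v < \<xi> l0 (P n) - \<xi> k (P n)"
      using gap[OF l0] finite_K by (intro eventually_ball_finite) auto
    then show ?thesis
    proof eventually_elim
      case (elim n)
      have "\<xi> k (P n - v) \<le> \<xi> l0 (P n - v)" if "k \<in> K - L" for k
        using bspec[OF elim that] that l0 L by (auto simp: xi_diff subset_iff)
      then show ?case using l0 by (intro nu_on_dominated[OF finite_K L \<open>L \<noteq> {}\<close>]) blast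
    qed
  qed
  have "f v = horo \<xi> L p v" for v
  proof (rule LIMSEQ_unique[OF f])
    have eq: "horo \<xi> L (P n) = horo \<xi> L (s n)" for n
      using horo_add_H[OF L \<open>L \<noteq> {}\<close> h, of "s n" n] by simp
    have "\<forall>\<^sub>F n in sequentially. horo \<xi> L (s n) v = horo \<xi> K (P n) v"
      using ev[of v] ev[of 0]
    proof eventually_elim
      case (elim n)
      then show ?case unfolding eq[symmetric] by (simp add: horo_def)
    qed
    then show "(\<lambda>n. horo \<xi> K (P n) v) \<longlonglongrightarrow> horo \<xi> L p v"
      by (rule Lim_transform_eventually[OF tendsto_horo[OF L \<open>L \<noteq> {}\<close> s]])
  qed
  then show thesis using that[OF face] by blast
qed

lemma bordification_eq: "bordification K \<xi> = {horo \<xi> L p | L p. L \<in> faces}"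
proof (intro subset_antisym subsetI)
  fix f assume "f \<in> {horo \<xi> L p | L p. L \<in> faces}"
  then show "f \<in> bordification K \<xi>" using horo_in_bordification by blast
next
  fix f assume "f \<in> bordification K \<xi>"
  then have f: "f \<in> bounded_convergence_topology closure_of (range (horo \<xi> K))"
    unfolding bordification_def range_horo_K .
  \<comment> \<open>Radius and tolerance are coupled to one index, so a sequence suffices and
    converges pointwise, as \<open>horo_limit\<close> requires.\<close>
  have "\<exists>p. \<forall>v. norm v \<le> real n \<longrightarrow> \<bar>horo \<xi> K p v - f v\<bar> < 1 / Suc n" for n
    using bounded_convergence_closureD[OF f, of "1 / Suc n" "real n"] by auto
  then obtain P where P: "\<And>n v. norm v \<le> real n \<Longrightarrow> \<bar>horo \<xi> K (P n) v - f v\<bar> < 1 / Suc n"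
    by metis
  have "(\<lambda>n. horo \<xi> K (P n) v) \<longlonglongrightarrow> f v" for v
  proof (rule LIM_zero_cancel, rule Lim_null_comparison)
    show "\<forall>\<^sub>F n in sequentially. norm (horo \<xi> K (P n) v - f v) \<le> 1 / Suc n"
      using eventually_ge_at_top[of "nat \<lceil>norm v\<rceil>"]
      by eventually_elim (use P in \<open>force simp: nat_le_iff ceiling_le_iff intro: less_imp_le\<close>)
    show "(\<lambda>n. 1 / real (Suc n)) \<longlonglongrightarrow> 0" by (rule LIMSEQ_Suc[OF lim_1_over_n])
  qed
  then obtain L p where "L \<in> faces" "f = horo \<xi> L p" by (rule horo_limit)
  then show "f \<in> {horo \<xi> L p | L p. L \<in> faces}" by blast
qed

section \<open>The bijection \<open>Phi\<close> and the topology it imposes\<close>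

lemma Phi_horo:
  assumes L: "L \<in> faces" shows "Phi K \<xi> (horo \<xi> L p) = (L, coset \<xi> L p)"
proof -
  have Phi: "Phi K \<xi> f = (THE x. \<exists>L'\<in>faces. \<exists>p'. f = horo \<xi> L' p' \<and> x = (L', coset \<xi> L' p'))" for f
    unfolding Phi_def horo_def[symmetric] by (simp add: coset_K)
  have unique: "(L', coset \<xi> L' p') = (L, coset \<xi> L p)"
    if "L' \<in> faces" "horo \<xi> L p = horo \<xi> L' p'" for L' p'
    using horo_inj[OF facesD(1,2)[OF L] facesD(1,2)[OF that(1)] that(2)] by simp
  show ?thesis unfolding Phi
  proof (rule the_equality)
    show "\<exists>L'\<in>faces. \<exists>p'. horo \<xi> L p = horo \<xi> L' p' \<and> (L, coset \<xi> L p) = (L', coset \<xi> L' p')"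
      using L by blast
    fix x assume "\<exists>L'\<in>faces. \<exists>p'. horo \<xi> L p = horo \<xi> L' p' \<and> x = (L', coset \<xi> L' p')"
    then obtain L' p' where "L' \<in> faces" "horo \<xi> L p = horo \<xi> L' p'" "x = (L', coset \<xi> L' p')"
      by blast
    then show "x = (L, coset \<xi> L p)" using unique[of L' p'] by simp
  qed
qed

lemma inj_on_Phi: "inj_on (Phi K \<xi>) (bordification K \<xi>)"
proof (rule inj_onI)
  fix f g assume "f \<in> bordification K \<xi>" "g \<in> bordification K \<xi>" and eq: "Phi K \<xi> f = Phi K \<xi> g"
  then obtain L p L' p' where f: "L \<in> faces" "f = horo \<xi> L p" and g: "L' \<in> faces" "g = horo \<xi> L' p'"
    unfolding bordification_eq by blast
  have LL': "L' = L" and co: "coset \<xi> L p' = coset \<xi> L p" using eq f g by (auto simp: Phi_horo)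
  note LK = facesD[OF f(1)]
  have "p' + 0 \<in> coset \<xi> L p'"
    unfolding coset_def using subspace_0[OF subspace_H[OF LK(1)]] by (rule imageI)
  then obtain h where "h \<in> H \<xi> L" "p' = p + h" using co by (auto simp: coset_def)
  then show "f = g" using f g LL' horo_add_H[OF LK(1,2)] by simp
qed

lemma inv_Phi:
  "L \<in> faces \<Longrightarrow> inv_into (bordification K \<xi>) (Phi K \<xi>) (L, coset \<xi> L p) = horo \<xi> L p"
  using inv_into_f_f[OF inj_on_Phi horo_in_bordification] by (metis Phi_horo)

text \<open>By \<open>inv_Phi\<close> the inverse of \<open>Phi\<close> sends a coset to the
  horofunction of any representative, so open sets can be described without the inverse.\<close>

lemma openin_Phi_topology:
  "openin (Phi_topology K \<xi>) W \<longleftrightarrow> (\<exists>V. openin bounded_convergence_topology V \<and>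
    W = {(L, coset \<xi> L p) | L p. L \<in> faces \<and> horo \<xi> L p \<in> V})"
proof -
  let ?f = "inv_into (bordification K \<xi>) (Phi K \<xi>)"
  have eq: "?f -` (V \<inter> bordification K \<xi>) \<inter> quotient_union K \<xi> =
      {(L, coset \<xi> L p) | L p. L \<in> faces \<and> horo \<xi> L p \<in> V}" for V
  proof (intro subset_antisym subsetI)
    fix x assume x: "x \<in> ?f -` (V \<inter> bordification K \<xi>) \<inter> quotient_union K \<xi>"
    then obtain L p where "L \<in> faces" "x = (L, coset \<xi> L p)"
      unfolding quotient_union_eq by blast
    then show "x \<in> {(L, coset \<xi> L p) | L p. L \<in> faces \<and> horo \<xi> L p \<in> V}"
      using x inv_Phi by fastforce
  next
    fix x assume "x \<in> {(L, coset \<xi> L p) | L p. L \<in> faces \<and> horo \<xi> L p \<in> V}"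
    then obtain L p where "L \<in> faces" "x = (L, coset \<xi> L p)" "horo \<xi> L p \<in> V" by blast
    then show "x \<in> ?f -` (V \<inter> bordification K \<xi>) \<inter> quotient_union K \<xi>"
      using horo_in_bordification inv_Phi unfolding quotient_union_eq by simp
  qed
  show ?thesis
    unfolding Phi_topology_def openin_pullback_topology openin_subtopology
    using eq by (metis (no_types, lifting))
qed

lemma topspace_Phi_topology: "topspace (Phi_topology K \<xi>) = {(L, coset \<xi> L p) | L p. L \<in> faces}"
  (is "_ = ?T")
proof
  show "topspace (Phi_topology K \<xi>) \<subseteq> ?T"
    using openin_topspace[of "Phi_topology K \<xi>"] unfolding openin_Phi_topology by blast
  have "horo \<xi> L p \<in> based_functions" if "L \<in> faces" for L p
    using horo_based[OF facesD(1,2)[OF that]] .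
  then have "?T = {(L, coset \<xi> L p) | L p. L \<in> faces \<and> horo \<xi> L p \<in> based_functions}" by blast
  then have "openin (Phi_topology K \<xi>) ?T"
    unfolding openin_Phi_topology using openin_based_functions by blast
  then show "?T \<subseteq> topspace (Phi_topology K \<xi>)" by (rule openin_subset)
qed

lemma neighborhood_basis_U:
  assumes L: "L \<in> faces"
  shows "neighborhood_basis_at (Phi_topology K \<xi>) (L, coset \<xi> L p)
    {U K \<xi> L \<epsilon> (p + q) | q \<epsilon>. q \<in> Hplus K \<xi> L \<and> \<epsilon> > 0}"
  unfolding neighborhood_basis_at_def
proof (intro conjI ballI allI impI)
  show "(L, coset \<xi> L p) \<in> topspace (Phi_topology K \<xi>)"
    using L unfolding topspace_Phi_topology by blast
  fix N assume "N \<in> {U K \<xi> L \<epsilon> (p + q) | q \<epsilon>. q \<in> Hplus K \<xi> L \<and> \<epsilon> > 0}"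
  then obtain q \<epsilon> where q: "q \<in> H \<xi> L" and "0 < \<epsilon>" and N: "N = U K \<xi> L \<epsilon> (p + q)"
    by (auto simp: Hplus_eq)
  show "N \<subseteq> topspace (Phi_topology K \<xi>)"
    unfolding N U_eq[OF L] topspace_Phi_topology by blast
  obtain R e where e: "0 < e"
    "\<And>L' p'. L' \<in> faces \<Longrightarrow> (\<And>v. norm v \<le> R \<Longrightarrow> \<bar>horo \<xi> L' p' v - horo \<xi> L p v\<bar> < e) \<Longrightarrow>
      (L', coset \<xi> L' p') \<in> N"
    using horo_neighborhood_subset_U[OF L q \<open>0 < \<epsilon>\<close>, of p] unfolding N by metis
  define V where "V = {g \<in> based_functions. \<exists>d<e. \<forall>v\<in>cball 0 R. \<bar>g v - horo \<xi> L p v\<bar> \<le> d}"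
  define W where "W = {(L, coset \<xi> L p) | L p. L \<in> faces \<and> horo \<xi> L p \<in> V}"
  have "openin bounded_convergence_topology V"
    unfolding V_def by (intro openin_uniform_neighborhood) simp
  then have "openin (Phi_topology K \<xi>) W" unfolding openin_Phi_topology W_def by blast
  moreover have "horo \<xi> L p \<in> V"
    using horo_based[OF facesD(1,2)[OF L]] e(1) by (auto simp: V_def)
  then have "(L, coset \<xi> L p) \<in> W" using L unfolding W_def by blast
  moreover have "W \<subseteq> N"
  proof
    fix x assume "x \<in> W"
    then obtain L' p' where x: "L' \<in> faces" "x = (L', coset \<xi> L' p')" "horo \<xi> L' p' \<in> V"
      unfolding W_def by blast
    then obtain d where "d < e" "\<forall>v\<in>cball 0 R. \<bar>horo \<xi> L' p' v - horo \<xi> L p v\<bar> \<le> d"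
      unfolding V_def by blast
    then have "\<bar>horo \<xi> L' p' v - horo \<xi> L p v\<bar> < e" if "norm v \<le> R" for v
      using that by force
    then show "x \<in> N" using e(2) x by blast
  qed
  ultimately show "\<exists>W. openin (Phi_topology K \<xi>) W \<and> (L, coset \<xi> L p) \<in> W \<and> W \<subseteq> N" by blast
next
  fix W assume "openin (Phi_topology K \<xi>) W \<and> (L, coset \<xi> L p) \<in> W"
  then obtain V where V: "openin bounded_convergence_topology V"
      and W: "W = {(L, coset \<xi> L p) | L p. L \<in> faces \<and> horo \<xi> L p \<in> V}"
      and "(L, coset \<xi> L p) \<in> W"
    unfolding openin_Phi_topology by blast
  then obtain p' where "horo \<xi> L p' \<in> V" "coset \<xi> L p = coset \<xi> L p'" by blast
  \<comment> \<open>Membership in \<open>W\<close> only provides some representative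
    \<open>p'\<close>; the inverse of \<open>Phi\<close> identifies its horofunction with that of
    \<open>p\<close>.\<close>
  then have "horo \<xi> L p \<in> V" using inv_Phi[OF L, of p] inv_Phi[OF L, of p'] by simp
  then obtain R e where R: "0 \<le> R" "0 < e"
    "\<And>g. g \<in> based_functions \<Longrightarrow> (\<And>v. norm v \<le> R \<Longrightarrow> \<bar>g v - horo \<xi> L p v\<bar> < e) \<Longrightarrow> g \<in> V"
    using open_bounded_convergenceD[OF V] by metis
  obtain q \<epsilon> where q: "q \<in> Hplus K \<xi> L" "0 < \<epsilon>"
    "\<And>L' b h v. L' \<in> faces \<Longrightarrow> L \<subseteq> L' \<Longrightarrow> norm b < \<epsilon> \<Longrightarrow> h \<in> Hplus K \<xi> L \<Longrightarrow> norm v \<le> R \<Longrightarrow>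
      \<bar>horo \<xi> L' (p + q + b + h) v - horo \<xi> L p v\<bar> < e"
    using U_subset_horo_neighborhood[OF L R(2,1)] by metis
  have "U K \<xi> L \<epsilon> (p + q) \<subseteq> W"
  proof
    fix x assume "x \<in> U K \<xi> L \<epsilon> (p + q)"
    then obtain L' b h where x: "x = (L', coset \<xi> L' (p + q + b + h))" "L' \<in> faces" "L \<subseteq> L'"
      "norm b < \<epsilon>" "h \<in> Hplus K \<xi> L" unfolding U_eq[OF L] by blast
    then have "horo \<xi> L' (p + q + b + h) \<in> V"
      using q(3) horo_based[OF facesD(1,2)[OF x(2)]] by (intro R(3)) auto
    then show "x \<in> W" using x unfolding W by blast
  qed
  then show "\<exists>N\<in>{U K \<xi> L \<epsilon> (p + q) | q \<epsilon>. q \<in> Hplus K \<xi> L \<and> \<epsilon> > 0}. N \<subseteq> W"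
    using q by blast
qed

end

section \<open>Polyhedral norms from convex polyhedra\<close>

text \<open>If \<open>f u > 1\<close>, then \<open>u\<close> scaled to the level 1 would lie on the
  facet. It also lies strictly between the interior point 0 and \<open>u\<close>, hence in the
  interior of \<open>B\<close>, which a proper face does not meet.\<close>

lemma facet_functional_le_1:
  fixes f :: "'a::euclidean_space \<Rightarrow> real"
  assumes "convex B" "0 \<in> interior B" "linear f" and facet: "{v \<in> B. f v = 1} facet_of B" and "u \<in> B"
  shows "f u \<le> 1"
proof (rule ccontr)
  assume "\<not> f u \<le> 1"
  then have u: "1 < f u" by simp
  have "u - (1 - 1 / f u) *\<^sub>R (u - 0) \<in> interior B"
    using assms closure_subset u by (intro mem_interior_closure_convex_shrink) auto
  moreover have "u - (1 - 1 / f u) *\<^sub>R (u - 0) = (1 / f u) *\<^sub>R u" by (simp add: algebra_simps)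
  ultimately have int: "(1 / f u) *\<^sub>R u \<in> interior B" by simp
  have "f ((1 / f u) *\<^sub>R u) = 1" using u linear_cmul[OF \<open>linear f\<close>] by simp
  then have "(1 / f u) *\<^sub>R u \<in> {v \<in> B. f v = 1} \<inter> interior B"
    using int interior_subset by blast
  moreover have "{v \<in> B. f v = 1} \<inter> interior B = {}"
  proof (rule face_of_disjoint_interior[OF facet_of_imp_face_of[OF facet]])
    show "{v \<in> B. f v = 1} \<noteq> B" using facet facet_of_irrefl[of B] by force
  qed
  ultimately show False by blast
qed

lemma polyhedral_norm_of_polyhedron:
  fixes B :: "'a::euclidean_space set"
  assumes B: "compact B" "convex B" "polyhedron B" "0 \<in> interior B"
    and K: "finite K" "K \<noteq> {}" and A: "bij_betw A K {F. F facet_of B}"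
    and lin: "\<And>j. j \<in> K \<Longrightarrow> linear (\<xi> j)"
    and A_eq: "\<And>j. j \<in> K \<Longrightarrow> A j = {v \<in> B. \<xi> j v = 1}"
  obtains w \<eta> where "polyhedral_norm K \<xi> w \<eta>"
proof -
  have facet: "A j facet_of B" if "j \<in> K" for j using A that by (auto simp: bij_betw_def)
  \<comment> \<open>A ray from 0 in a nonzero direction \<open>u\<close> leaves the compact set
    \<open>B\<close> on some facet, whose functional is 1 there and therefore positive at
    \<open>u\<close>.\<close>
  have definite: "u = 0" if u: "\<And>k. k \<in> K \<Longrightarrow> \<xi> k u \<le> 0" for u
  proof (rule ccontr)
    assume "u \<noteq> 0"
    then obtain d where d: "0 < d" "0 + d *\<^sub>R u \<in> frontier B"
      using ray_to_frontier[OF compact_imp_bounded[OF B(1)] B(4)] by metis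
    have "frontier B = \<Union>{F. F facet_of B}"
      using rel_frontier_of_polyhedron[OF B(3)] rel_frontier_nonempty_interior[of B] B(4) by auto
    then obtain F where "F \<in> {F. F facet_of B}" "d *\<^sub>R u \<in> F" using d(2) by auto
    then obtain j where j: "j \<in> K" "d *\<^sub>R u \<in> A j"
      unfolding bij_betw_imp_surj_on[OF A, symmetric] by blast
    then have "d * \<xi> j u = 1" using A_eq linear_cmul[OF lin] by auto
    moreover have "d * \<xi> j u \<le> 0" using d u j by (simp add: mult_nonneg_nonpos)
    ultimately show False by simp
  qed
  have "\<exists>x. \<xi> k x = 1 \<and> (\<forall>j\<in>K - {k}. \<xi> j x < 1)" if k: "k \<in> K" for k
  proof -
    have face: "A k face_of B" and "A k \<noteq> {}" using facet[OF k] by (auto simp: facet_of_def)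
    then obtain x where x: "x \<in> rel_interior (A k)"
      using rel_interior_eq_empty[OF face_of_imp_convex[OF face]] by blast
    then have xA: "x \<in> A k" using rel_interior_subset by blast
    \<comment> \<open>If a second facet met the relative interior of \<open>A k\<close>, it would
      contain \<open>A k\<close> as a proper face, although all facets have the same
      dimension.\<close>
    have "\<xi> j x < 1" if j: "j \<in> K - {k}" for j
    proof (rule ccontr)
      assume "\<not> \<xi> j x < 1"
      have Aj: "A j facet_of B" and jK: "j \<in> K" using facet j by auto
      have xB: "x \<in> B" using xA facet_of_imp_subset[OF facet[OF k]] by blast
      have "\<xi> j x \<le> 1"
        using facet_functional_le_1[OF B(2,4) lin[OF jK] _ xB] Aj A_eq[OF jK] by simp
      then have "x \<in> A j" using A_eq[OF jK] xB \<open>\<not> \<xi> j x < 1\<close> by simp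
      then have "A j \<inter> rel_interior (A k) \<noteq> {}" using x by blast
      with Aj have sub: "A k \<subseteq> A j"
        by (intro subset_of_face_of[OF facet_of_imp_face_of facet_of_imp_subset[OF facet[OF k]]])
      have "A k face_of A j"
        using face_of_subset[OF face sub facet_of_imp_subset[OF Aj]] .
      moreover have "A k \<noteq> A j" using A j k by (auto simp: bij_betw_def inj_on_def)
      moreover have "convex (A j)" using face_of_imp_convex[OF facet_of_imp_face_of[OF Aj]] .
      ultimately have "aff_dim (A k) < aff_dim (A j)" by (intro face_of_aff_dim_lt)
      then show False using facet[OF k] Aj by (simp add: facet_of_def)
    qed
    then show ?thesis using xA A_eq[OF k] by blast
  qed
  then obtain w where w: "\<And>k. k \<in> K \<Longrightarrow> \<xi> k (w k) = 1" "\<And>j k. k \<in> K \<Longrightarrow> j \<in> K - {k} \<Longrightarrow> \<xi> j (w k) < 1"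
    by metis
  obtain \<eta> where \<eta>: "0 < \<eta>"
    "\<And>x. x \<in> (SIGMA k:K. K - {k}) \<Longrightarrow> \<eta> \<le> (case x of (k, j) \<Rightarrow> 1 - \<xi> j (w k))"
    by (rule finite_uniform_gap[of "SIGMA k:K. K - {k}" "\<lambda>(k, j). 1 - \<xi> j (w k)"])
      (use w K in auto)
  have "polyhedral_norm K \<xi> w \<eta>"
  proof (rule polyhedral_norm.intro)
    show "\<xi> j (w k) \<le> 1 - \<eta>" if "j \<in> K" "k \<in> K" "j \<noteq> k" for j k
      using \<eta>(2)[of "(k, j)"] that by auto
  qed (use K lin definite w(1) \<eta>(1) in blast)+
  then show thesis by (rule that)
qed

theorem corollary6p25:
  fixes B :: "'a::euclidean_space set" and m :: nat and K :: "nat set"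
    and A :: "nat \<Rightarrow> 'a set" and \<xi> :: "nat \<Rightarrow> 'a \<Rightarrow> real"
    and p :: 'a and L :: "nat set"
  assumes "compact B" and "convex B" and "polyhedron B" and "0 \<in> interior B"
    and "K = {0..m}"
    and "bij_betw A K {F. F facet_of B}"
    and "\<And>j. j \<in> K \<Longrightarrow> linear (\<xi> j)"
    and "\<And>j. j \<in> K \<Longrightarrow> A j = {v \<in> B. \<xi> j v = 1}"
    and "L \<in> dual_faces K \<xi> \<union> {K}"
  shows "neighborhood_basis_at (Phi_topology K \<xi>) (L, coset \<xi> L p)
           {U K \<xi> L \<epsilon> (p + q) | q \<epsilon>. q \<in> Hplus K \<xi> L \<and> \<epsilon> > 0}"
proof -
  have "finite K" "K \<noteq> {}" using \<open>K = {0..m}\<close> by auto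
  then obtain w \<eta> where "polyhedral_norm K \<xi> w \<eta>"
    using polyhedral_norm_of_polyhedron[OF assms(1-4) _ _ assms(6-8)] by blast
  then interpret polyhedral_norm K \<xi> w \<eta> .
  show ?thesis using assms(9) by (intro neighborhood_basis_U) simp
qed

end
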